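(* Let $n\ge 2$ and consider the ordinary differential equation $$y^{(n)}=\omega\left(x,y,y',\dots,y^{(n-1)}\right).$$ Let $\mathcal{L}$ be the (finite-dimensional) Lie algebra of infinitesimal generators of one-parameter local Lie groups of uniform contact symmetries of this equation, with basis $$X_i=\xi_i(x,y,y')\,\partial_x+\eta_i(x,y,y')\,\partial_y+\eta_i^{(1)}(x,y,y')\,\partial_{y'},\qquad i=1,\dots,N,$$ and structure constants $c_{ij}^k$ defined by $[X_i,X_j]=\sum_{k=1}^N c_{ij}^kX_k$. Let $$\Gamma:(x,y,y')\mapsto\left(\hat x,\hat y,\hat y'\right)$$ be any uniform contact symmetry of the equation, and let $\hat X_i$ denote the vector field obtained from $X_i$ by replacing $(x,y,y')$ by $(\hat x,\hat y,\hat y')$, i.e. $$\hat X_i=\xi_i(\hat x,\hat y,\hat y')\,\partial_{\hat x}+\eta_i(\hat x,\hat y,\hat y')\,\partial_{\hat y}+\eta_i^{(1)}(\hat x,\hat y,\hat y')\,\partial_{\hat y'},\qquad i=1,\dots,N.$$ Then $\hat X_i\in\mathcal{L}$ for every $i$, and the linear map determined by $X_i\mapsto\hat X_i$ is an automorphism of the Lie algebra $\mathcal{L}$. There exists a constant non-singular $N\times N$ matrix $\left(b_i^l\right)$ such that $$X_i=\sum_{l=1}^N b_i^l\hat X_l,\qquad i=1,\dots,N,$$ and the automorphism preserves all structure constants: $$[\hat X_i,\hat X_j]=\sum_{k=1}^N c_{ij}^k\hat X_k,\qquad i,j=1,\dots,N.$$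
   Context: All functions are smooth. The function $\omega$ is defined on an open set of the space with coordinates $(x,y,y',\dots,y^{(n-1)})$, and $M$ denotes the corresponding open set of points $(x,y,y')$ (the projection of the domain of $\omega$). Write $D=\partial_x+y'\partial_y+y''\partial_{y'}+\cdots$ for the total derivative operator. Uniform contact symmetry. A uniform contact transformation is a diffeomorphism $\Gamma:M\to M$ of the form $$\hat x=\Phi(x,y'),\qquad \hat y=ky+\Theta(x,y'),\qquad \hat y'=\Psi(x,y'),\qquad k\in\mathbb{R}\setminus\{0\},$$ satisfying the contact condition $$ky'+\Theta_x=\Phi_x\Psi,\qquad \Theta_{y'}=\Phi_{y'}\Psi .$$ It is prolonged to higher derivatives, wherever $D\hat x\neq0$, by $\hat y^{(j)}=D\hat y^{(j-1)}/D\hat x$ with $\hat y^{(0)}=\hat y$. It is a uniform contact symmetry of the equation $y^{(n)}=\omega$ if it maps the set of solutions to itself, i.e. if $\hat y^{(n)}=\omega(\hat x,\hat y,\hat y',\dots,\hat y^{(n-1)})$ whenever $y^{(n)}=\omega(x,y,y',\dots,y^{(n-1)})$. This is understood as follows: $D\hat x\ne 0$ on a dense open subset of the set of points $(x,y,\dots,y^{(n)})$ satisfying the equation, and at all such points $(\hat x,\hat y,\dots,\hat y^{(n-1)})$ lies in the domain of $\omega$ and the transformed equation holds. Generators of uniform Lie contact symmetries. $\mathcal{L}$ is the set of vector fields $X=\xi\partial_x+\eta\partial_y+\eta^{(1)}\partial_{y'}$ on $M$ for which there is a characteristic function of the form $$Q=c_1y+\phi(x,y'),\qquad c_1\in\mathbb{R},$$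 with $$\xi=-Q_{y'},\qquad \eta=Q-y'Q_{y'},\qquad \eta^{(1)}=Q_x+y'Q_y,$$ and which satisfy the linearized symmetry condition: with $\eta^{(j)}=D^jQ-y^{(j+1)}Q_{y'}$ for $j\ge1$ and $\eta^{(0)}=\eta$, one has $$\eta^{(n)}=\xi\,\omega_x+\sum_{j=0}^{n-1}\eta^{(j)}\,\frac{\partial\omega}{\partial y^{(j)}}\qquad\text{whenever } y^{(n)}=\omega .$$ Standing assumption: for the given equation of order $n\ge2$, $\mathcal{L}$ is a finite-dimensional Lie algebra under the commutator of vector fields, $N=\dim\mathcal{L}\geq 1$. The vector field $\hat X_i$. The functions $(\hat x,\hat y,\hat y')$ are used as coordinates on $M$ and $\partial_{\hat x},\partial_{\hat y},\partial_{\hat y'}$ are the associated coordinate vector fields. Thus $\hat X_i$ is the unique vector field on $M$ with $\hat X_i\hat x=\xi_i(\hat x,\hat y,\hat y')$, $\hat X_i\hat y=\eta_i(\hat x,\hat y,\hat y')$, $\hat X_i\hat y'=\eta^{(1)}_i(\hat x,\hat y,\hat y')$, i.e. the pull-back $\Gamma^*X_i$ (in the paper's operator notation, $\hat X_i=\Gamma X_i\Gamma^{-1}$). *)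

theory Defs
  imports "HOL-Analysis.Analysis" "HOL-Analysis.Finite_Function_Topology" "HOL-Library.Function_Algebras"
begin

section \<open>Pointwise vector space structure on functions\<close>

instantiation "fun" :: (type, real_vector) real_vector
begin

definition scaleR_fun :: "real \<Rightarrow> ('a \<Rightarrow> 'b) \<Rightarrow> 'a \<Rightarrow> 'b"
  where "scaleR_fun r f = (\<lambda>x. r *\<^sub>R f x)"

instance
  by standard (simp_all add: scaleR_fun_def fun_eq_iff scaleR_add_right scaleR_add_left)

end


section \<open>Smooth functions\<close>

text \<open>Intended for open sets \<open>S\<close>.\<close>

primrec Ck_on :: "nat \<Rightarrow> 'a::real_normed_vector set \<Rightarrow> ('a \<Rightarrow> 'b::real_normed_vector) \<Rightarrow> bool"
  where
    "Ck_on 0 S f \<longleftrightarrow> continuous_on S f"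
  | "Ck_on (Suc k) S f \<longleftrightarrow>
       (\<forall>p\<in>S. f differentiable (at p)) \<and>
       (\<forall>v. Ck_on k S (\<lambda>p. frechet_derivative f (at p) v))"

definition smooth_on :: "'a::real_normed_vector set \<Rightarrow> ('a \<Rightarrow> 'b::real_normed_vector) \<Rightarrow> bool"
  where "smooth_on S f \<longleftrightarrow> (\<forall>k. Ck_on k S f)"

definition diffeomorphism_on :: "'a::real_normed_vector set \<Rightarrow> ('a \<Rightarrow> 'a) \<Rightarrow> bool"
  where "diffeomorphism_on M \<Gamma> \<longleftrightarrow>
    bij_betw \<Gamma> M M \<and> smooth_on M \<Gamma> \<and> smooth_on M (inv_into M \<Gamma>)"


section \<open>Jets\<close>

text \<open>
  A jet \<open>(x, u)\<close> has coordinates \<open>x\<close> and \<open>y\<^sup>(\<^sup>j\<^sup>) = lookup u j\<close> for all \<open>j\<close>, finitely many of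
  them nonzero. A function of \<open>(x, y, \<dots>, y\<^sup>(\<^sup>m\<^sup>))\<close> is a function of jets that does not depend on the
  coordinates beyond \<open>y\<^sup>(\<^sup>m\<^sup>)\<close>, and a set of points \<open>(x, y, \<dots>, y\<^sup>(\<^sup>m\<^sup>))\<close> is represented by the
  cylinder over it. For these, continuity, openness, density and differentiability with respect to
  the norm on jets agree with the notions for finitely many real coordinates, and the
  restriction to finitely supported sequences loses nothing.
\<close>

type_synonym jet = "real \<times> (nat, real) poly_mapping"

definition yc :: "nat \<Rightarrow> jet \<Rightarrow> real"
  where "yc j p = Poly_Mapping.lookup (snd p) j"

definition jet_agree :: "nat \<Rightarrow> jet \<Rightarrow> jet \<Rightarrow> bool"
  where "jet_agree n p q \<longleftrightarrow> fst p = fst q \<and> (\<forall>j<n. yc j p = yc j q)"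

text \<open>\<open>\<omega>\<close> is a smooth function of \<open>(x, y, \<dots>, y\<^sup>(\<^sup>n\<^sup>-\<^sup>1\<^sup>))\<close> with open domain \<open>U\<close>.\<close>

definition ode_rhs :: "nat \<Rightarrow> jet set \<Rightarrow> (jet \<Rightarrow> real) \<Rightarrow> bool"
  where "ode_rhs n U \<omega> \<longleftrightarrow>
    open U \<and> smooth_on U \<omega> \<and>
    (\<forall>p q. jet_agree n p q \<longrightarrow> p \<in> U \<longrightarrow> q \<in> U \<and> \<omega> q = \<omega> p)"

definition ode_set :: "nat \<Rightarrow> jet set \<Rightarrow> (jet \<Rightarrow> real) \<Rightarrow> jet set"
  where "ode_set n U \<omega> = {p \<in> U. yc n p = \<omega> p}"

definition jet_dx :: "(jet \<Rightarrow> real) \<Rightarrow> jet \<Rightarrow> real"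
  where "jet_dx f p = frechet_derivative f (at p) (1, 0)"

definition jet_dy :: "nat \<Rightarrow> (jet \<Rightarrow> real) \<Rightarrow> jet \<Rightarrow> real"
  where "jet_dy j f p = frechet_derivative f (at p) (0, Poly_Mapping.single j 1)"

text \<open>The sum has finitely many terms, since jets have finite support.\<close>

definition total_deriv :: "(jet \<Rightarrow> real) \<Rightarrow> jet \<Rightarrow> real"
  where "total_deriv f p =
    jet_dx f p + (\<Sum>j | yc (Suc j) p \<noteq> 0. yc (Suc j) p * jet_dy j f p)"


section \<open>The space of points \<open>(x, y, y')\<close>\<close>

type_synonym point = "real \<times> real \<times> real"

type_synonym vfield = "point \<Rightarrow> point"

definition base :: "jet \<Rightarrow> point"
  where "base p = (fst p, yc 0 p, yc 1 p)"

definition xy1_proj :: "point set \<Rightarrow> (real \<times> real) set"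
  where "xy1_proj M = (\<lambda>(x, y, y1). (x, y1)) ` M"

text \<open>
  A vector field on \<open>M\<close> is given by its components with respect to \<open>\<partial>\<^sub>x\<close>, \<open>\<partial>\<^sub>y\<close>, \<open>\<partial>\<^sub>y\<^sub>'\<close>, and is
  extended by \<open>0\<close> outside \<open>M\<close>, so that equality of functions is equality on \<open>M\<close>.
\<close>

definition lie_bracket :: "point set \<Rightarrow> vfield \<Rightarrow> vfield \<Rightarrow> vfield"
  where "lie_bracket M X Y = (\<lambda>m. if m \<in> M
    then frechet_derivative Y (at m) (X m) - frechet_derivative X (at m) (Y m) else 0)"

definition lie_automorphism :: "point set \<Rightarrow> vfield set \<Rightarrow> (vfield \<Rightarrow> vfield) \<Rightarrow> bool"
  where "lie_automorphism M L T \<longleftrightarrow>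
    bij_betw T L L \<and>
    (\<forall>X\<in>L. \<forall>Y\<in>L. T (X + Y) = T X + T Y) \<and>
    (\<forall>r. \<forall>X\<in>L. T (r *\<^sub>R X) = r *\<^sub>R T X) \<and>
    (\<forall>X\<in>L. \<forall>Y\<in>L. T (lie_bracket M X Y) = lie_bracket M (T X) (T Y))"

text \<open>
  The field \<open>Z\<close> with \<open>Z x\<^sub>1 = \<xi> \<circ> \<Gamma>\<close>, \<open>Z y\<^sub>1 = \<eta> \<circ> \<Gamma>\<close>, \<open>Z y'\<^sub>1 = \<eta>\<^sup>(\<^sup>1\<^sup>) \<circ> \<Gamma>\<close>, where
  \<open>\<Gamma> = (x\<^sub>1, y\<^sub>1, y'\<^sub>1)\<close> and \<open>X = (\<xi>, \<eta>, \<eta>\<^sup>(\<^sup>1\<^sup>))\<close>. It exists uniquely if \<open>\<Gamma>\<close> is a diffeomorphism of \<open>M\<close>.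
\<close>

definition pullback :: "point set \<Rightarrow> (point \<Rightarrow> point) \<Rightarrow> vfield \<Rightarrow> vfield"
  where "pullback M \<Gamma> X = (\<lambda>m. if m \<in> M
    then (THE v. frechet_derivative \<Gamma> (at m) v = X (\<Gamma> m)) else 0)"


section \<open>Uniform contact symmetries\<close>

definition uniform_contact_transformation :: "point set \<Rightarrow> (point \<Rightarrow> point) \<Rightarrow> bool"
  where "uniform_contact_transformation M \<Gamma> \<longleftrightarrow>
    diffeomorphism_on M \<Gamma> \<and>
    (\<exists>(k::real) (\<Phi>::real \<times> real \<Rightarrow> real) (\<Theta>::real \<times> real \<Rightarrow> real) (\<Psi>::real \<times> real \<Rightarrow> real).
       k \<noteq> 0 \<and>
       smooth_on (xy1_proj M) \<Phi> \<and> smooth_on (xy1_proj M) \<Theta> \<and> smooth_on (xy1_proj M) \<Psi> \<and>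
       (\<forall>(x, y, y1)\<in>M. \<Gamma> (x, y, y1) = (\<Phi> (x, y1), k * y + \<Theta> (x, y1), \<Psi> (x, y1))) \<and>
       (\<forall>(x, y1)\<in>xy1_proj M.
          k * y1 + frechet_derivative \<Theta> (at (x, y1)) (1, 0)
            = frechet_derivative \<Phi> (at (x, y1)) (1, 0) * \<Psi> (x, y1) \<and>
          frechet_derivative \<Theta> (at (x, y1)) (0, 1)
            = frechet_derivative \<Phi> (at (x, y1)) (0, 1) * \<Psi> (x, y1)))"

definition x_hat :: "(point \<Rightarrow> point) \<Rightarrow> jet \<Rightarrow> real"
  where "x_hat \<Gamma> p = fst (\<Gamma> (base p))"

text \<open>Meaningful only at jets where \<open>total_deriv (x_hat \<Gamma>)\<close> does not vanish.\<close>

primrec y_hat :: "(point \<Rightarrow> point) \<Rightarrow> nat \<Rightarrow> jet \<Rightarrow> real"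
  where
    "y_hat \<Gamma> 0 = (\<lambda>p. fst (snd (\<Gamma> (base p))))"
  | "y_hat \<Gamma> (Suc j) = (\<lambda>p. total_deriv (y_hat \<Gamma> j) p / total_deriv (x_hat \<Gamma>) p)"

text \<open>The coordinates from \<open>y\<^sup>(\<^sup>n\<^sup>)\<close> on are irrelevant here and set to \<open>0\<close>.\<close>

definition prolong :: "nat \<Rightarrow> (point \<Rightarrow> point) \<Rightarrow> jet \<Rightarrow> jet"
  where "prolong n \<Gamma> p = (x_hat \<Gamma> p, \<Sum>j<n. Poly_Mapping.single j (y_hat \<Gamma> j p))"

definition uniform_contact_symmetry ::
    "nat \<Rightarrow> jet set \<Rightarrow> (jet \<Rightarrow> real) \<Rightarrow> (point \<Rightarrow> point) \<Rightarrow> bool"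
  where "uniform_contact_symmetry n U \<omega> \<Gamma> \<longleftrightarrow>
    uniform_contact_transformation (base ` U) \<Gamma> \<and>
    (let E = ode_set n U \<omega>; R = {p \<in> E. total_deriv (x_hat \<Gamma>) p \<noteq> 0}
     in openin (top_of_set E) R \<and> E \<subseteq> closure R \<and>
        (\<forall>p\<in>R. prolong n \<Gamma> p \<in> U \<and> y_hat \<Gamma> n p = \<omega> (prolong n \<Gamma> p)))"


section \<open>Generators\<close>

definition d3x :: "(point \<Rightarrow> real) \<Rightarrow> point \<Rightarrow> real"
  where "d3x Q m = frechet_derivative Q (at m) (1, 0, 0)"

definition d3y :: "(point \<Rightarrow> real) \<Rightarrow> point \<Rightarrow> real"
  where "d3y Q m = frechet_derivative Q (at m) (0, 1, 0)"

definition d3y1 :: "(point \<Rightarrow> real) \<Rightarrow> point \<Rightarrow> real"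
  where "d3y1 Q m = frechet_derivative Q (at m) (0, 0, 1)"

definition char_field :: "point set \<Rightarrow> (point \<Rightarrow> real) \<Rightarrow> vfield"
  where "char_field M Q = (\<lambda>m. if m \<in> M
    then (let y1 = snd (snd m) in
      (- d3y1 Q m, Q m - y1 * d3y1 Q m, d3x Q m + y1 * d3y Q m)) else 0)"

text \<open>For \<open>j = 0\<close> this is the component \<open>\<eta>\<close>.\<close>

definition prol_coeff :: "(point \<Rightarrow> real) \<Rightarrow> nat \<Rightarrow> jet \<Rightarrow> real"
  where "prol_coeff Q j p =
    (total_deriv ^^ j) (\<lambda>q. Q (base q)) p - yc (Suc j) p * d3y1 Q (base p)"

definition linearized_symmetry_condition ::
    "nat \<Rightarrow> jet set \<Rightarrow> (jet \<Rightarrow> real) \<Rightarrow> (point \<Rightarrow> real) \<Rightarrow> bool"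
  where "linearized_symmetry_condition n U \<omega> Q \<longleftrightarrow>
    (\<forall>p\<in>ode_set n U \<omega>.
       prol_coeff Q n p
         = - d3y1 Q (base p) * jet_dx \<omega> p + (\<Sum>j<n. prol_coeff Q j p * jet_dy j \<omega> p))"

definition uniform_generators :: "nat \<Rightarrow> jet set \<Rightarrow> (jet \<Rightarrow> real) \<Rightarrow> vfield set"
  where "uniform_generators n U \<omega> =
    {char_field (base ` U) Q | Q.
       (\<exists>(c::real) (\<phi>::real \<times> real \<Rightarrow> real). smooth_on (xy1_proj (base ` U)) \<phi> \<and>
          Q = (\<lambda>(x, y, y1). c * y + \<phi> (x, y1))) \<and>
       linearized_symmetry_condition n U \<omega> Q}"

end

theory Submission
  imports Defs
begin

text \<open>
  Let \<open>X\<close> have the characteristic \<open>Q = c y + \<phi>(x, y')\<close>. A uniform contact transformation multiplies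
  the contact form \<open>dy - y' dx\<close> by the constant \<open>k\<close>, so the pulled-back field has the characteristic
  \<open>Q' = (Q \<circ> \<Gamma>) / k\<close>, which is again of the form \<open>c y + \<phi>'(x, y')\<close> because \<open>\<Gamma>\<close> is affine in \<open>y\<close>
  with the constant slope \<open>k\<close>. The proof that \<open>Q'\<close> satisfies the linearized symmetry condition is the
  core; linear algebra and the naturality of the Lie bracket give the rest.

  The condition is best read in evolutionary form. The evolutionary field of \<open>Q\<close> is
  \<open>\<Sum>\<^sub>j (D\<^sup>j Q) \<partial>/\<partial>y\<^sup>(\<^sup>j\<^sup>)\<close>; it commutes with the total derivative \<open>D\<close>. With \<open>F = y\<^sup>(\<^sup>n\<^sup>) - \<omega>\<close>, the
  linearized symmetry condition says that the evolutionary field of \<open>Q\<close> maps \<open>F\<close> to \<open>Q\<^sub>y\<^sub>' D F\<close> on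
  \<open>F = 0\<close> (\<open>linearized_condition_iff_evolution\<close>). Let \<open>E\<close> and \<open>E'\<close> be the evolutionary fields of
  \<open>Q\<close> and \<open>Q'\<close>. By commutation with \<open>D\<close>, the prolongation of \<open>\<Gamma>\<close> carries \<open>E'\<close> to \<open>E + \<mu> D\<close>,
  where \<open>\<mu>\<close> is the derivative of the transformed \<open>x\<close> along \<open>E'\<close> (\<open>evolution_y_hat\<close>), and it carries
  \<open>D\<close> to a multiple of \<open>D\<close> (\<open>total_deriv_compose_prolong\<close>).

  Since \<open>\<Gamma>\<close> is a symmetry, \<open>G = F \<circ> pr \<Gamma>\<close> vanishes where \<open>F\<close> does, hence \<open>dG = \<lambda> dF\<close> at points of
  the equation; here \<open>\<lambda>\<close> is the derivative of the transformed \<open>y\<^sup>(\<^sup>n\<^sup>)\<close> by \<open>y\<^sup>(\<^sup>n\<^sup>)\<close>, which is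
  nonzero because the Jacobian of \<open>(x, y') \<mapsto> (\<Phi>, \<Psi>)\<close> equals \<open>k\<close> (\<open>jet_dy_y_hat_nonzero\<close>).
  Evaluating \<open>dG\<close> on \<open>E'\<close> and on \<open>D\<close> turns the condition for \<open>Q\<close> at the image jet into the condition
  for \<open>Q'\<close> at the original one, wherever the transformed \<open>x\<close> has nonzero total derivative. These jets
  are dense in the equation and the condition is closed, so it holds everywhere
  (\<open>linearized_symmetry_condition_pullback\<close>).

  Thus the pull-back maps \<open>\<L>\<close> into itself. It is linear, and injective because \<open>\<Gamma>\<close> is onto \<open>M\<close>, hence
  bijective on the finite-dimensional space \<open>\<L>\<close>; the matrix \<open>b\<close> is that of its inverse.
\<close>

section \<open>Calculus of smooth functions\<close>

lemma has_derivative_frechet: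
  "f differentiable (at p) \<Longrightarrow> (f has_derivative frechet_derivative f (at p)) (at p)"
  by (simp add: frechet_derivative_works)

lemma frechet_derivative_eqI:
  "(f has_derivative f') (at p) \<Longrightarrow> frechet_derivative f (at p) v = f' v"
  by (simp add: frechet_derivative_at[symmetric])

lemma Ck_on_cong:
  assumes "open S" "\<And>p. p \<in> S \<Longrightarrow> f p = g p" "Ck_on k S f"
  shows "Ck_on k S g"
  using assms(2,3)
proof (induction k arbitrary: f g)
  case 0
  then show ?case by (auto intro: continuous_on_eq)
next
  case (Suc k)
  have d: "g differentiable (at p)" "frechet_derivative f (at p) = frechet_derivative g (at p)"
    if "p \<in> S" for p
  proof -
    have f: "f differentiable (at p)" using Suc.prems(2) that by simp
    have "(g has_derivative frechet_derivative f (at p)) (at p)"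
      using has_derivative_transform_within_open[OF has_derivative_frechet[OF f] assms(1) that]
        Suc.prems(1) by blast
    then show "g differentiable (at p)" "frechet_derivative f (at p) = frechet_derivative g (at p)"
      by (auto simp: differentiable_def dest: frechet_derivative_at)
  qed
  have "Ck_on k S (\<lambda>p. frechet_derivative g (at p) v)" for v
    using Suc.IH[of "\<lambda>p. frechet_derivative f (at p) v" "\<lambda>p. frechet_derivative g (at p) v"]
      d(2) Suc.prems(2) by simp
  then show ?case using d(1) by simp
qed

lemma Ck_on_subset: "Ck_on k S f \<Longrightarrow> T \<subseteq> S \<Longrightarrow> Ck_on k T f"
  by (induction k arbitrary: f) (auto intro: continuous_on_subset)

lemma Ck_on_Suc_lower: "Ck_on (Suc k) S f \<Longrightarrow> Ck_on k S f"
proof (induction k arbitrary: f)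
  case 0
  then show ?case
    by (auto intro!: continuous_at_imp_continuous_on differentiable_imp_continuous_within)
next
  case (Suc k)
  then show ?case by (metis Ck_on.simps(2))
qed

text \<open>
  Every closure property below is an induction on the order in which this rule reduces the step to a
  formula for the first derivative.
\<close>

lemma Ck_on_SucI:
  assumes "open S" "\<And>p. p \<in> S \<Longrightarrow> (f has_derivative f' p) (at p)"
    and "\<And>v. Ck_on k S (\<lambda>p. f' p v)"
  shows "Ck_on (Suc k) S f"
proof -
  have "Ck_on k S (\<lambda>p. frechet_derivative f (at p) v)" for v
    by (rule Ck_on_cong[OF assms(1) _ assms(3)[of v]])
      (simp add: frechet_derivative_eqI[OF assms(2)])
  then show ?thesis using assms(2) by (auto simp: differentiable_def)
qed

lemma Ck_on_const: "Ck_on k S (\<lambda>p. c)"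
  by (induction k arbitrary: c) auto

lemma Ck_on_bounded_linear:
  assumes "open S" "bounded_linear f"
  shows "Ck_on k S f"
proof (cases k)
  case 0
  then show ?thesis using assms(2) by (simp add: linear_continuous_on)
next
  case (Suc k')
  show ?thesis unfolding Suc
    by (rule Ck_on_SucI[OF assms(1) bounded_linear_imp_has_derivative[OF assms(2)] Ck_on_const])
qed

lemma Ck_on_add:
  assumes "open S"
  shows "Ck_on k S f \<Longrightarrow> Ck_on k S g \<Longrightarrow> Ck_on k S (\<lambda>p. f p + g p)"
proof (induction k arbitrary: f g)
  case 0
  then show ?case by (simp add: continuous_on_add)
next
  case (Suc k)
  show ?case
  proof (rule Ck_on_SucI[OF assms])
    show "((\<lambda>p. f p + g p) has_derivative
      (\<lambda>v. frechet_derivative f (at p) v + frechet_derivative g (at p) v)) (at p)" if "p \<in> S" for p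
      using Suc.prems that by (intro has_derivative_add has_derivative_frechet) auto
  qed (use Suc in auto)
qed

lemma Ck_on_bilinear:
  assumes "open S" "bounded_bilinear bil"
  shows "Ck_on k S f \<Longrightarrow> Ck_on k S g \<Longrightarrow> Ck_on k S (\<lambda>p. bil (f p) (g p))"
proof (induction k arbitrary: f g)
  case 0
  then show ?case using bounded_bilinear.continuous_on[OF assms(2)] by auto
next
  case (Suc k)
  show ?case
  proof (rule Ck_on_SucI[OF assms(1)])
    show "((\<lambda>p. bil (f p) (g p)) has_derivative
      (\<lambda>v. bil (f p) (frechet_derivative g (at p) v) + bil (frechet_derivative f (at p) v) (g p)))
        (at p)" if "p \<in> S" for p
      using Suc.prems that
      by (intro bounded_bilinear.FDERIV[OF assms(2)] has_derivative_frechet) auto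
    show "Ck_on k S (\<lambda>p. bil (f p) (frechet_derivative g (at p) v)
        + bil (frechet_derivative f (at p) v) (g p))" for v
      using Suc.prems Suc.prems[THEN Ck_on_Suc_lower] by (intro Ck_on_add[OF assms(1)] Suc.IH) auto
  qed
qed

lemma Ck_on_sum:
  assumes "open S" "\<And>i. i \<in> I \<Longrightarrow> Ck_on k S (f i)"
  shows "Ck_on k S (\<lambda>p. \<Sum>i\<in>I. f i p)"
  using assms(2)
  by (induction I rule: infinite_finite_induct)
    (auto simp: Ck_on_const intro!: Ck_on_add[OF assms(1)])

lemma linear_euclidean_expand:
  fixes v :: "'b::euclidean_space"
  assumes "linear g"
  shows "g v = (\<Sum>b\<in>Basis. (v \<bullet> b) *\<^sub>R g b)"
proof -
  have "g v = g (\<Sum>b\<in>Basis. (v \<bullet> b) *\<^sub>R b)" by (simp add: euclidean_representation)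
  also have "\<dots> = (\<Sum>b\<in>Basis. (v \<bullet> b) *\<^sub>R g b)"
    by (simp add: linear_sum[OF assms] linear_cmul[OF assms])
  finally show ?thesis .
qed

text \<open>
  The chain rule is expanded in a basis of the intermediate space, so that only derivatives in fixed
  directions occur and the induction hypothesis applies to them. This is where the intermediate space
  has to be Euclidean.
\<close>

lemma Ck_on_compose:
  fixes g :: "'b::euclidean_space \<Rightarrow> 'c::real_normed_vector"
  assumes "open S" "open T" "f ` S \<subseteq> T"
  shows "Ck_on k S f \<Longrightarrow> Ck_on k T g \<Longrightarrow> Ck_on k S (\<lambda>p. g (f p))"
proof (induction k arbitrary: g)
  case 0
  then show ?case using assms(3) by (auto intro: continuous_on_compose2)
next
  case (Suc k)
  show ?case
  proof (rule Ck_on_SucI[OF assms(1)])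
    fix p assume p: "p \<in> S"
    have g: "g differentiable (at (f p))" using Suc.prems(2) p assms(3) by auto
    have "((\<lambda>p. g (f p)) has_derivative
        (\<lambda>v. frechet_derivative g (at (f p)) (frechet_derivative f (at p) v))) (at p)"
      by (rule has_derivative_compose[where g = g and g' = "frechet_derivative g (at (f p))"])
        (use Suc.prems p g in \<open>auto intro: has_derivative_frechet\<close>)
    also have "(\<lambda>v. frechet_derivative g (at (f p)) (frechet_derivative f (at p) v)) =
      (\<lambda>v. \<Sum>b\<in>Basis. (frechet_derivative f (at p) v \<bullet> b) *\<^sub>R frechet_derivative g (at (f p)) b)"
      using linear_euclidean_expand[OF linear_frechet_derivative[OF g]] by blast
    finally show "((\<lambda>p. g (f p)) has_derivative
      (\<lambda>v. \<Sum>b\<in>Basis. (frechet_derivative f (at p) v \<bullet> b) *\<^sub>R frechet_derivative g (at (f p)) b))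
        (at p)" .
  next
    have f: "Ck_on k S f" using Suc.prems(1) by (rule Ck_on_Suc_lower)
    have g: "Ck_on k S (\<lambda>p. frechet_derivative g (at (f p)) b)" for b
      by (rule Suc.IH[OF f]) (use Suc.prems(2) in simp)
    have f': "Ck_on k S (\<lambda>p. frechet_derivative f (at p) v \<bullet> b)" for v b
      using Suc.prems(1)
      by (intro Ck_on_bilinear[where bil = "(\<bullet>)", OF assms(1) bounded_bilinear_inner] Ck_on_const) auto
    show "Ck_on k S (\<lambda>p. \<Sum>b\<in>Basis. (frechet_derivative f (at p) v \<bullet> b)
        *\<^sub>R frechet_derivative g (at (f p)) b)" for v
      by (rule Ck_on_sum[OF assms(1)])
        (rule Ck_on_bilinear[where bil = scaleR, OF assms(1) bounded_bilinear_scaleR f' g])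
  qed
qed

lemma Ck_on_inverse:
  fixes f :: "'a::real_normed_vector \<Rightarrow> real"
  assumes "open S" "\<And>p. p \<in> S \<Longrightarrow> f p \<noteq> 0"
  shows "Ck_on k S f \<Longrightarrow> Ck_on k S (\<lambda>p. inverse (f p))"
proof (induction k)
  case 0
  then show ?case using assms(2) by (auto intro: continuous_on_inverse)
next
  case (Suc k)
  show ?case
  proof (rule Ck_on_SucI[OF assms(1)])
    show "((\<lambda>p. inverse (f p)) has_derivative
      (\<lambda>v. - 1 * (inverse (f p) * frechet_derivative f (at p) v * inverse (f p)))) (at p)"
      if "p \<in> S" for p
      using Suc.prems that assms(2)[OF that]
        has_derivative_inverse[where f = f and x = p and f' = "frechet_derivative f (at p)" and S = UNIV]
      by (auto simp: has_derivative_frechet)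
    show "Ck_on k S (\<lambda>p. - 1 * (inverse (f p) * frechet_derivative f (at p) v * inverse (f p)))" for v
      using Suc.prems Suc.IH Ck_on_Suc_lower[OF Suc.prems]
      by (intro Ck_on_bilinear[where bil = "(*)", OF assms(1) bounded_bilinear_mult] Ck_on_const) auto
  qed
qed

lemma Ck_on_Pair:
  assumes "open S"
  shows "Ck_on k S f \<Longrightarrow> Ck_on k S g \<Longrightarrow> Ck_on k S (\<lambda>p. (f p, g p))"
proof (induction k arbitrary: f g)
  case 0
  then show ?case by (simp add: continuous_on_Pair)
next
  case (Suc k)
  show ?case
  proof (rule Ck_on_SucI[OF assms])
    show "((\<lambda>p. (f p, g p)) has_derivative
      (\<lambda>v. (frechet_derivative f (at p) v, frechet_derivative g (at p) v))) (at p)" if "p \<in> S" for p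
      using Suc.prems that by (intro has_derivative_Pair has_derivative_frechet) auto
  qed (use Suc in auto)
qed

lemma smooth_on_cong:
  assumes "open S" "\<And>p. p \<in> S \<Longrightarrow> f p = g p" "smooth_on S f"
  shows "smooth_on S g"
  unfolding smooth_on_def
proof
  show "Ck_on k S g" for k
    by (rule Ck_on_cong[OF assms(1,2)]) (use assms(3) in \<open>simp_all add: smooth_on_def\<close>)
qed

lemma smooth_on_subset: "smooth_on S f \<Longrightarrow> T \<subseteq> S \<Longrightarrow> smooth_on T f"
  unfolding smooth_on_def by (blast intro: Ck_on_subset)

lemma smooth_on_differentiable: "smooth_on S f \<Longrightarrow> p \<in> S \<Longrightarrow> f differentiable (at p)"
  unfolding smooth_on_def by (drule spec[where x = "Suc 0"]) simp

lemma smooth_on_continuous: "smooth_on S f \<Longrightarrow> continuous_on S f"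
  unfolding smooth_on_def by (drule spec[where x = 0]) simp

lemma smooth_on_frechet_derivative:
  "smooth_on S f \<Longrightarrow> smooth_on S (\<lambda>p. frechet_derivative f (at p) v)"
  unfolding smooth_on_def
proof
  fix k assume "\<forall>k. Ck_on k S f"
  then show "Ck_on k S (\<lambda>p. frechet_derivative f (at p) v)"
    by (drule_tac x = "Suc k" in spec) simp
qed

lemma smooth_on_has_derivative:
  "smooth_on S f \<Longrightarrow> p \<in> S \<Longrightarrow> (f has_derivative frechet_derivative f (at p)) (at p)"
  by (rule has_derivative_frechet[OF smooth_on_differentiable])

lemma smooth_on_const: "smooth_on S (\<lambda>p. c)"
  by (simp add: smooth_on_def Ck_on_const)

lemma smooth_on_bounded_linear: "open S \<Longrightarrow> bounded_linear f \<Longrightarrow> smooth_on S f"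
  by (simp add: smooth_on_def Ck_on_bounded_linear)

lemma smooth_on_add:
  "open S \<Longrightarrow> smooth_on S f \<Longrightarrow> smooth_on S g \<Longrightarrow> smooth_on S (\<lambda>p. f p + g p)"
  by (simp add: smooth_on_def Ck_on_add)

lemma smooth_on_mult:
  fixes f :: "'a::real_normed_vector \<Rightarrow> real"
  shows "open S \<Longrightarrow> smooth_on S f \<Longrightarrow> smooth_on S g \<Longrightarrow> smooth_on S (\<lambda>p. f p * g p)"
  by (simp add: smooth_on_def Ck_on_bilinear[where bil = "(*)", OF _ bounded_bilinear_mult])

lemma smooth_on_diff:
  fixes f :: "'a::real_normed_vector \<Rightarrow> real"
  assumes "open S" "smooth_on S f" "smooth_on S g"
  shows "smooth_on S (\<lambda>p. f p - g p)"
  using smooth_on_add[OF assms(1,2) smooth_on_mult[OF assms(1) smooth_on_const assms(3), of "- 1"]]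
  by simp

lemma smooth_on_divide:
  fixes f :: "'a::real_normed_vector \<Rightarrow> real"
  assumes "open S" "smooth_on S f" "smooth_on S g" "\<And>p. p \<in> S \<Longrightarrow> g p \<noteq> 0"
  shows "smooth_on S (\<lambda>p. f p / g p)"
proof -
  have "smooth_on S (\<lambda>p. inverse (g p))"
    using assms by (simp add: smooth_on_def Ck_on_inverse)
  from smooth_on_mult[OF assms(1,2) this] show ?thesis by (simp add: divide_inverse)
qed

lemma smooth_on_Pair:
  "open S \<Longrightarrow> smooth_on S f \<Longrightarrow> smooth_on S g \<Longrightarrow> smooth_on S (\<lambda>p. (f p, g p))"
  by (simp add: smooth_on_def Ck_on_Pair)

lemma smooth_on_compose:
  fixes g :: "'b::euclidean_space \<Rightarrow> 'c::real_normed_vector"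
  assumes "open S" "open T" "\<And>p. p \<in> S \<Longrightarrow> f p \<in> T" "smooth_on S f" "smooth_on T g"
  shows "smooth_on S (\<lambda>p. g (f p))"
  unfolding smooth_on_def
proof
  show "Ck_on k S (\<lambda>p. g (f p))" for k
    by (rule Ck_on_compose[OF assms(1,2)]) (use assms(3-5) in \<open>auto simp: smooth_on_def\<close>)
qed

section \<open>Symmetry of second derivatives\<close>

text \<open>
  Two applications of the mean value theorem, first along \<open>v\<close> and then along \<open>w\<close>. The second
  difference is symmetric in \<open>v\<close> and \<open>w\<close>, the right-hand side is not.
\<close>

lemma second_difference_mean_value:
  fixes f :: "'a::real_normed_vector \<Rightarrow> real"
  assumes f: "smooth_on S f" and "0 < h"
    and S: "\<And>s t. 0 \<le> s \<Longrightarrow> s \<le> h \<Longrightarrow> 0 \<le> t \<Longrightarrow> t \<le> h \<Longrightarrow> p + s *\<^sub>R v + t *\<^sub>R w \<in> S"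
  obtains s t where "0 \<le> s" "s \<le> h" "0 \<le> t" "t \<le> h"
    "f (p + h *\<^sub>R v + h *\<^sub>R w) - f (p + h *\<^sub>R v) - f (p + h *\<^sub>R w) + f p
      = h * h * frechet_derivative (\<lambda>q. frechet_derivative f (at q) v) (at (p + s *\<^sub>R v + t *\<^sub>R w)) w"
proof -
  define f1 where "f1 = (\<lambda>q. frechet_derivative f (at q) v)"
  define f2 where "f2 = (\<lambda>q. frechet_derivative f1 (at q) w)"
  have S0: "p + s *\<^sub>R v \<in> S" if "0 \<le> s" "s \<le> h" for s
    using S[OF that, of 0] \<open>0 < h\<close> by simp
  have d1: "((\<lambda>s. f (q + s *\<^sub>R v)) has_derivative (\<lambda>r. r * f1 (q + s *\<^sub>R v))) (at s within T)"
    if "q + s *\<^sub>R v \<in> S" for q s T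
  proof -
    have lin: "linear (frechet_derivative f (at (q + s *\<^sub>R v)))"
      by (rule linear_frechet_derivative[OF smooth_on_differentiable[OF f that]])
    have "((\<lambda>s. q + s *\<^sub>R v) has_derivative (\<lambda>r. r *\<^sub>R v)) (at s within T)"
      by (auto intro!: derivative_eq_intros)
    from has_derivative_compose[where g = f, OF this smooth_on_has_derivative[OF f that]]
    show ?thesis by (simp add: f1_def linear_cmul[OF lin])
  qed
  have f1: "smooth_on S f1" unfolding f1_def by (rule smooth_on_frechet_derivative[OF f])
  have d2: "((\<lambda>t. f1 (q + t *\<^sub>R w)) has_derivative (\<lambda>r. r * f2 (q + t *\<^sub>R w))) (at t within T)"
    if "q + t *\<^sub>R w \<in> S" for q t T
  proof -
    have lin: "linear (frechet_derivative f1 (at (q + t *\<^sub>R w)))"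
      by (rule linear_frechet_derivative[OF smooth_on_differentiable[OF f1 that]])
    have "((\<lambda>s. q + s *\<^sub>R w) has_derivative (\<lambda>r. r *\<^sub>R w)) (at t within T)"
      by (auto intro!: derivative_eq_intros)
    from has_derivative_compose[where g = f1, OF this smooth_on_has_derivative[OF f1 that]]
    show ?thesis by (simp add: f2_def linear_cmul[OF lin])
  qed
  define g where "g = (\<lambda>s. f ((p + h *\<^sub>R w) + s *\<^sub>R v) - f (p + s *\<^sub>R v))"
  have "(g has_derivative (\<lambda>r. r * f1 ((p + h *\<^sub>R w) + s *\<^sub>R v) - r * f1 (p + s *\<^sub>R v)))
      (at s within {0..h})" if "0 \<le> s" "s \<le> h" for s
    unfolding g_def using S[OF that, of h] S0[OF that] \<open>0 < h\<close>
    by (intro has_derivative_diff d1) (auto simp: algebra_simps)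
  from mvt_very_simple[of 0 h g, OF _ this] \<open>0 < h\<close>
  obtain s where s: "0 \<le> s" "s \<le> h"
    and gs: "g h - g 0 = h * f1 ((p + h *\<^sub>R w) + s *\<^sub>R v) - h * f1 (p + s *\<^sub>R v)"
    by auto
  have "((\<lambda>t. f1 ((p + s *\<^sub>R v) + t *\<^sub>R w)) has_derivative
      (\<lambda>r. r * f2 ((p + s *\<^sub>R v) + t *\<^sub>R w))) (at t within {0..h})" if "0 \<le> t" "t \<le> h" for t
    using S[OF s that] by (intro d2) auto
  from mvt_very_simple[of 0 h "\<lambda>t. f1 ((p + s *\<^sub>R v) + t *\<^sub>R w)", OF _ this] \<open>0 < h\<close>
  obtain t where t: "0 \<le> t" "t \<le> h"
    and ft: "f1 ((p + s *\<^sub>R v) + h *\<^sub>R w) - f1 (p + s *\<^sub>R v) = h * f2 (p + s *\<^sub>R v + t *\<^sub>R w)"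
    by auto
  have "f (p + h *\<^sub>R v + h *\<^sub>R w) - f (p + h *\<^sub>R v) - f (p + h *\<^sub>R w) + f p = g h - g 0"
    by (simp add: g_def algebra_simps)
  also have "\<dots> = h * (f1 ((p + s *\<^sub>R v) + h *\<^sub>R w) - f1 (p + s *\<^sub>R v))"
    by (simp add: gs algebra_simps)
  finally show ?thesis using that[OF s t] ft by (simp add: f1_def f2_def)
qed

text \<open>
  Both mixed derivatives are limits of the same second difference quotient, by continuity at \<open>p\<close>.
\<close>

lemma second_derivative_symmetric_real:
  fixes f :: "'a::real_normed_vector \<Rightarrow> real"
  assumes "open S" and f: "smooth_on S f" and p: "p \<in> S"
  shows "frechet_derivative (\<lambda>q. frechet_derivative f (at q) v) (at p) w
    = frechet_derivative (\<lambda>q. frechet_derivative f (at q) w) (at p) v"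
proof -
  define A where "A = (\<lambda>q. frechet_derivative (\<lambda>q. frechet_derivative f (at q) v) (at q) w)"
  define B where "B = (\<lambda>q. frechet_derivative (\<lambda>q. frechet_derivative f (at q) w) (at q) v)"
  have cont: "continuous (at p) A" "continuous (at p) B"
    unfolding A_def B_def using p
    by (auto intro!: continuous_on_interior[where S = S] smooth_on_continuous
        smooth_on_frechet_derivative f simp: interior_open[OF \<open>open S\<close>])
  have "\<bar>A p - B p\<bar> \<le> e" if "0 < e" for e
  proof -
    obtain d1 where d1: "0 < d1" "\<And>q. dist q p < d1 \<Longrightarrow> dist (A q) (A p) < e / 2"
      using cont(1)[unfolded continuous_at_eps_delta, rule_format, of "e / 2"] \<open>0 < e\<close> by auto
    obtain d2 where d2: "0 < d2" "\<And>q. dist q p < d2 \<Longrightarrow> dist (B q) (B p) < e / 2"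
      using cont(2)[unfolded continuous_at_eps_delta, rule_format, of "e / 2"] \<open>0 < e\<close> by auto
    obtain d3 where d3: "0 < d3" "\<And>q. dist q p < d3 \<Longrightarrow> q \<in> S"
      using \<open>open S\<close> p unfolding open_dist by blast
    \<comment> \<open>The three radii give closeness of \<open>A\<close>, closeness of \<open>B\<close>, and containment in \<open>S\<close>.\<close>
    define d where "d = min d1 (min d2 d3)"
    \<comment> \<open>Any \<open>h\<close> that keeps the parallelogram spanned by \<open>h v\<close> and \<open>h w\<close> in the ball of radius \<open>d\<close>.\<close>
    define h where "h = d / (norm v + norm w + 1)"
    have d: "0 < d" "d \<le> d1" "d \<le> d2" "d \<le> d3" using d1 d2 d3 by (auto simp: d_def)
    have nz: "0 < norm v + norm w + 1" by (simp add: add_nonneg_pos)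
    have h: "0 < h" using d nz by (simp add: h_def)
    have near: "dist (p + s *\<^sub>R v + t *\<^sub>R w) p < d" if "0 \<le> s" "s \<le> h" "0 \<le> t" "t \<le> h" for s t
    proof -
      have "dist (p + s *\<^sub>R v + t *\<^sub>R w) p \<le> norm (s *\<^sub>R v) + norm (t *\<^sub>R w)"
        by (simp add: dist_norm norm_triangle_ineq add.assoc del: norm_scaleR)
      also have "\<dots> \<le> h * norm v + h * norm w"
        using that by (auto intro!: add_mono mult_right_mono)
      also have "\<dots> < h * (norm v + norm w + 1)" using h by (simp add: algebra_simps)
      also have "\<dots> = d" using nz by (simp add: h_def)
      finally show ?thesis .
    qed
    define \<Delta> where "\<Delta> = f (p + h *\<^sub>R v + h *\<^sub>R w) - f (p + h *\<^sub>R v) - f (p + h *\<^sub>R w) + f p"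
    obtain s t where st: "0 \<le> s" "s \<le> h" "0 \<le> t" "t \<le> h"
      and a: "\<Delta> = h * h * A (p + s *\<^sub>R v + t *\<^sub>R w)"
      by (rule second_difference_mean_value[OF f h, of p v w])
        (use near d d3 in \<open>fastforce simp: A_def \<Delta>_def\<close>)+
    have sw: "p + t *\<^sub>R w + s *\<^sub>R v \<in> S" if "0 \<le> t" "t \<le> h" "0 \<le> s" "s \<le> h" for s t
      using near[OF that(3,4,1,2)] d d3 by (simp add: add.assoc add.commute[of "t *\<^sub>R w"])
    obtain t' s' where st': "0 \<le> t'" "t' \<le> h" "0 \<le> s'" "s' \<le> h"
      and b: "f (p + h *\<^sub>R w + h *\<^sub>R v) - f (p + h *\<^sub>R w) - f (p + h *\<^sub>R v) + f p
        = h * h * B (p + t' *\<^sub>R w + s' *\<^sub>R v)"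
      by (rule second_difference_mean_value[OF f h, of p w v]) (use sw in \<open>auto simp: B_def\<close>)
    have "\<Delta> = h * h * B (p + s' *\<^sub>R v + t' *\<^sub>R w)"
      using b by (simp add: \<Delta>_def algebra_simps)
    with a h have "A (p + s *\<^sub>R v + t *\<^sub>R w) = B (p + s' *\<^sub>R v + t' *\<^sub>R w)" by simp
    moreover have "dist (A (p + s *\<^sub>R v + t *\<^sub>R w)) (A p) < e / 2"
      using d1(2) near[OF st] d by simp
    moreover have "dist (B (p + s' *\<^sub>R v + t' *\<^sub>R w)) (B p) < e / 2"
      using d2(2) near[OF st'(3,4,1,2)] d by simp
    ultimately show ?thesis unfolding dist_real_def by linarith
  qed
  then have "\<bar>A p - B p\<bar> \<le> 0" by (rule field_le_epsilon) simp
  then have "A p = B p" by simp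
  then show ?thesis by (simp add: A_def B_def)
qed

lemma second_derivative_symmetric:
  fixes f :: "'a::real_normed_vector \<Rightarrow> 'b::euclidean_space"
  assumes "open S" and f: "smooth_on S f" and p: "p \<in> S"
  shows "frechet_derivative (\<lambda>q. frechet_derivative f (at q) v) (at p) w
    = frechet_derivative (\<lambda>q. frechet_derivative f (at q) w) (at p) v"
proof (rule euclidean_eqI)
  fix b :: 'b assume "b \<in> Basis"
  have inner: "frechet_derivative (\<lambda>q. g q \<bullet> b) (at q) u = frechet_derivative g (at q) u \<bullet> b"
    if "smooth_on S g" "q \<in> S" for g :: "'a \<Rightarrow> 'b" and q u
    by (rule frechet_derivative_eqI)
      (rule has_derivative_inner_left[OF smooth_on_has_derivative[OF that]])
  have fb: "smooth_on S (\<lambda>q. f q \<bullet> b)"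
    by (rule smooth_on_compose[OF assms(1) open_UNIV _ f]) (auto intro: smooth_on_bounded_linear
        bounded_linear_inner_left)
  have second: "frechet_derivative (\<lambda>q. frechet_derivative f (at q) u) (at p) z \<bullet> b
      = frechet_derivative (\<lambda>q. frechet_derivative (\<lambda>q. f q \<bullet> b) (at q) u) (at p) z" for u z
  proof -
    have "frechet_derivative (\<lambda>q. frechet_derivative f (at q) u) (at p) z \<bullet> b
        = frechet_derivative (\<lambda>q. frechet_derivative f (at q) u \<bullet> b) (at p) z"
      by (rule inner[symmetric, OF smooth_on_frechet_derivative[OF f] p])
    also have "\<dots> = frechet_derivative (\<lambda>q. frechet_derivative (\<lambda>q. f q \<bullet> b) (at q) u) (at p) z"
      by (rule frechet_derivative_transform_within_open[OF _ assms(1) p, THEN fun_cong])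
        (auto simp: inner f intro!: differentiable_inner
          smooth_on_differentiable[OF smooth_on_frechet_derivative[OF f] p])
    finally show ?thesis .
  qed
  show "frechet_derivative (\<lambda>q. frechet_derivative f (at q) v) (at p) w \<bullet> b
      = frechet_derivative (\<lambda>q. frechet_derivative f (at q) w) (at p) v \<bullet> b"
    unfolding second by (rule second_derivative_symmetric_real[OF assms(1) fb p])
qed

section \<open>Functions of finitely many jet coordinates\<close>

abbreviation jet_unit :: "nat \<Rightarrow> jet"
  where "jet_unit j \<equiv> (0, Poly_Mapping.single j 1)"

lemma lookup_scaleR: "Poly_Mapping.lookup (r *\<^sub>R u) i = r *\<^sub>R Poly_Mapping.lookup u i"
  for u :: "'a \<Rightarrow>\<^sub>0 'b::real_vector"
proof -
  have "finite {i. r *\<^sub>R Poly_Mapping.lookup u i \<noteq> 0}"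
    by (rule finite_subset[OF _ finite_lookup[of u]]) auto
  then show ?thesis by (simp add: scaleR_poly_mapping_def)
qed

lemma yc_add: "yc j (p + q) = yc j p + yc j q"
  by (simp add: yc_def lookup_add)

lemma yc_diff: "yc j (p - q) = yc j p - yc j q"
  by (simp add: yc_def lookup_minus)

lemma yc_scaleR: "yc j (r *\<^sub>R p) = r * yc j p"
  by (simp add: yc_def lookup_scaleR)

lemma yc_sum: "yc j (\<Sum>i\<in>I. f i) = (\<Sum>i\<in>I. yc j (f i))"
  by (simp add: yc_def lookup_sum snd_sum)

lemma yc_Pair_single: "yc j (a, Poly_Mapping.single i c) = (if i = j then c else 0)"
  by (simp add: yc_def lookup_single when_def)

lemma yc_Pair_sum: "yc j (a, \<Sum>i<N. Poly_Mapping.single i (c i)) = (if j < N then c j else 0)"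
  by (simp add: yc_def lookup_sum lookup_single when_def sum.delta')

lemma jet_single_eq: "Poly_Mapping.single j c = c *\<^sub>R Poly_Mapping.single j (1::real)"
  by (rule poly_mapping_eqI) (simp add: lookup_scaleR lookup_single when_def)

lemma abs_yc_le_norm: "\<bar>yc j p\<bar> \<le> norm p"
proof -
  have "\<bar>yc j p\<bar> \<le> (\<Sum>i\<in>Poly_Mapping.keys (snd p). \<bar>yc i p\<bar>)"
  proof (cases "j \<in> Poly_Mapping.keys (snd p)")
    case True
    then show ?thesis by (intro member_le_sum) auto
  next
    case False
    then have "yc j p = 0" by (simp add: yc_def in_keys_iff)
    then show ?thesis by (simp add: sum_nonneg)
  qed
  also have "\<dots> = norm (snd p)"
    by (simp add: norm_poly_mapping_def dist_poly_mapping_def yc_def)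
  also have "\<dots> \<le> norm p" by (metis norm_snd_le prod.collapse)
  finally show ?thesis .
qed

lemma bounded_linear_yc: "bounded_linear (yc j)"
  by (rule bounded_linear_intro[where K = 1]) (simp_all add: yc_add yc_scaleR abs_yc_le_norm)

lemma bounded_linear_base: "bounded_linear base"
  unfolding base_def by (intro bounded_linear_Pair bounded_linear_fst bounded_linear_yc)

lemma jet_eqI:
  assumes "fst p = fst q" "\<And>j. yc j p = yc j q"
  shows "p = q"
  using assms by (auto simp: yc_def prod_eq_iff intro!: poly_mapping_eqI)

text \<open>
  A jet is a finite combination of the coordinate directions because it has finite support.
\<close>

lemma linear_jet_expand:
  fixes L :: "jet \<Rightarrow> real"
  assumes "linear L"
  shows "L v = fst v * L (1, 0) + (\<Sum>j\<in>Poly_Mapping.keys (snd v). yc j v * L (jet_unit j))"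
proof -
  have "v = fst v *\<^sub>R (1, 0) + (\<Sum>j\<in>Poly_Mapping.keys (snd v). yc j v *\<^sub>R jet_unit j)" (is "_ = ?w")
  proof (rule jet_eqI)
    show "fst v = fst ?w" by (simp add: fst_sum)
    have zero: "yc j (1, 0) = 0" for j by (simp add: yc_def)
    show "yc j v = yc j ?w" for j
    proof -
      have "yc j ?w = (\<Sum>i\<in>Poly_Mapping.keys (snd v). yc i v * (if i = j then 1 else 0))"
        by (simp only: yc_add yc_scaleR yc_sum yc_Pair_single zero mult_zero_right add_0)
      also have "\<dots> = (\<Sum>i\<in>Poly_Mapping.keys (snd v). if i = j then yc i v else 0)"
        by (rule sum.cong) auto
      also have "\<dots> = yc j v" by (auto simp: in_keys_iff yc_def)
      finally show ?thesis by simp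
    qed
  qed
  then have "L v = L ?w" by simp
  also have "\<dots> = fst v *\<^sub>R L (1, 0) + (\<Sum>j\<in>Poly_Mapping.keys (snd v). yc j v *\<^sub>R L (jet_unit j))"
    by (simp only: linear_add[OF assms] linear_cmul[OF assms] linear_sum[OF assms])
  finally show ?thesis by simp
qed

text \<open>
  A smooth function of \<open>x\<close> and \<open>y\<^sup>(\<^sup>j\<^sup>)\<close> for \<open>j < m\<close>. The dependence is expressed by vanishing partial
  derivatives, a form that passes to derivatives of \<open>f\<close> by the symmetry of second derivatives.
\<close>

definition jet_function :: "nat \<Rightarrow> jet set \<Rightarrow> (jet \<Rightarrow> real) \<Rightarrow> bool"
  where "jet_function m S f \<longleftrightarrow> smooth_on S f \<and> (\<forall>p\<in>S. \<forall>j\<ge>m. jet_dy j f p = 0)"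

lemma jet_function_smooth: "jet_function m S f \<Longrightarrow> smooth_on S f"
  by (simp add: jet_function_def)

lemma jet_function_dy_zero: "jet_function m S f \<Longrightarrow> p \<in> S \<Longrightarrow> m \<le> j \<Longrightarrow> jet_dy j f p = 0"
  by (simp add: jet_function_def)

lemma jet_function_differentiable:
  "jet_function m S f \<Longrightarrow> p \<in> S \<Longrightarrow> f differentiable (at p)"
  by (blast intro: jet_function_smooth smooth_on_differentiable)

lemma jet_function_has_derivative:
  "jet_function m S f \<Longrightarrow> p \<in> S \<Longrightarrow> (f has_derivative frechet_derivative f (at p)) (at p)"
  by (blast intro: jet_function_smooth smooth_on_has_derivative)

lemma jet_function_mono: "jet_function m S f \<Longrightarrow> m \<le> m' \<Longrightarrow> T \<subseteq> S \<Longrightarrow> jet_function m' T f"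
  unfolding jet_function_def by (blast intro: smooth_on_subset order_trans)

lemma jet_functionI:
  assumes "smooth_on S f"
    and "\<And>p. p \<in> S \<Longrightarrow> (f has_derivative f' p) (at p)"
    and "\<And>p j. p \<in> S \<Longrightarrow> m \<le> j \<Longrightarrow> f' p (jet_unit j) = 0"
  shows "jet_function m S f"
  by (simp add: jet_function_def jet_dy_def frechet_derivative_eqI[OF assms(2)] assms(1,3))

lemma jet_function_cong:
  assumes "open S" "\<And>p. p \<in> S \<Longrightarrow> f p = g p" "jet_function m S f"
  shows "jet_function m S g"
proof (rule jet_functionI)
  show "smooth_on S g" by (rule smooth_on_cong[OF assms(1,2) jet_function_smooth[OF assms(3)]])
  show "(g has_derivative frechet_derivative f (at p)) (at p)" if "p \<in> S" for p
    by (rule has_derivative_transform_within_open[OF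
          jet_function_has_derivative[OF assms(3) that] assms(1) that assms(2)])
  show "frechet_derivative f (at p) (jet_unit j) = 0" if "p \<in> S" "m \<le> j" for p j
    using jet_function_dy_zero[OF assms(3) that] by (simp add: jet_dy_def)
qed

text \<open>
  The bound \<open>N\<close> is independent of the order \<open>m\<close>, so that functions of different orders can be
  treated with the same finite sum.
\<close>

lemma jet_function_derivative:
  assumes "jet_function m S f" "p \<in> S" "m \<le> N"
  shows "frechet_derivative f (at p) v = fst v * jet_dx f p + (\<Sum>j<N. yc j v * jet_dy j f p)"
proof -
  have "(\<Sum>j\<in>Poly_Mapping.keys (snd v). yc j v * jet_dy j f p) = (\<Sum>j<N. yc j v * jet_dy j f p)"
    using assms(3) jet_function_dy_zero[OF assms(1,2)]
    by (intro sum.mono_neutral_cong) (auto simp: yc_def in_keys_iff not_less)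
  moreover have "frechet_derivative f (at p) v = fst v * jet_dx f p
      + (\<Sum>j\<in>Poly_Mapping.keys (snd v). yc j v * jet_dy j f p)"
    unfolding jet_dx_def jet_dy_def
    by (rule linear_jet_expand[OF linear_frechet_derivative[OF
            jet_function_differentiable[OF assms(1,2)]]])
  ultimately show ?thesis by simp
qed

lemma total_deriv_eq:
  assumes "jet_function m S f" "p \<in> S" "m \<le> N"
  shows "total_deriv f p = jet_dx f p + (\<Sum>j<N. yc (Suc j) p * jet_dy j f p)"
proof -
  have "finite {j. yc (Suc j) p \<noteq> 0}"
    using finite_vimageI[OF finite_lookup[of "snd p"], of Suc] by (simp add: yc_def vimage_def)
  then have "(\<Sum>j | yc (Suc j) p \<noteq> 0. yc (Suc j) p * jet_dy j f p)
      = (\<Sum>j<N. yc (Suc j) p * jet_dy j f p)"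
    using assms(3) jet_function_dy_zero[OF assms(1,2)]
    by (intro sum.mono_neutral_cong) (auto simp: not_less)
  then show ?thesis by (simp add: total_deriv_def)
qed

text \<open>
  The direction of the total derivative, truncated so that it is a jet with a known finite expansion.
\<close>

definition total_direction :: "nat \<Rightarrow> jet \<Rightarrow> jet"
  where "total_direction N p = (1, \<Sum>j<N. Poly_Mapping.single j (yc (Suc j) p))"

lemma total_direction_components:
  "fst (total_direction N p) = 1"
  "yc j (total_direction N p) = (if j < N then yc (Suc j) p else 0)"
  by (simp_all add: total_direction_def yc_Pair_sum)

lemma total_deriv_frechet:
  assumes "jet_function m S f" "p \<in> S" "m \<le> N"
  shows "total_deriv f p = frechet_derivative f (at p) (total_direction N p)"
proof -
  have "fst (total_direction N p) = 1" by (simp add: total_direction_def)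
  moreover have "yc j (total_direction N p) = yc (Suc j) p" if "j < N" for j
    using that by (simp add: total_direction_def yc_Pair_sum)
  ultimately show ?thesis
    by (simp add: total_deriv_eq[OF assms] jet_function_derivative[OF assms])
qed

lemma total_deriv_cong:
  assumes "open S" "p \<in> S" "f differentiable (at p)" "\<And>q. q \<in> S \<Longrightarrow> f q = g q"
  shows "total_deriv f p = total_deriv g p"
  using frechet_derivative_transform_within_open[OF assms(3,1,2,4)]
  by (simp add: total_deriv_def jet_dx_def jet_dy_def)

lemma jet_function_const: "jet_function m S (\<lambda>p. c)"
  by (rule jet_functionI[where f' = "\<lambda>p v. 0"]) (simp_all add: smooth_on_const)

lemma jet_function_add:
  assumes "open S" "jet_function m S f" "jet_function m S g"
  shows "jet_function m S (\<lambda>p. f p + g p)"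
  by (rule jet_functionI[OF _ has_derivative_add])
    (use assms in \<open>auto intro: smooth_on_add jet_function_smooth jet_function_has_derivative
      simp: jet_function_dy_zero jet_dy_def[symmetric]\<close>)

lemma jet_function_mult:
  assumes "open S" "jet_function m S f" "jet_function m S g"
  shows "jet_function m S (\<lambda>p. f p * g p)"
  by (rule jet_functionI[OF _ has_derivative_mult])
    (use assms in \<open>auto intro: smooth_on_mult jet_function_smooth jet_function_has_derivative
      simp: jet_function_dy_zero jet_dy_def[symmetric]\<close>)

lemma jet_function_divide:
  assumes "open S" "jet_function m S f" "jet_function m S g" "\<And>p. p \<in> S \<Longrightarrow> g p \<noteq> 0"
  shows "jet_function m S (\<lambda>p. f p / g p)"
proof (rule jet_functionI)
  show "smooth_on S (\<lambda>p. f p / g p)"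
    by (rule smooth_on_divide) (use assms in \<open>auto intro: jet_function_smooth\<close>)
  show "((\<lambda>p. f p / g p) has_derivative (\<lambda>v. (frechet_derivative f (at p) v * g p
      - f p * frechet_derivative g (at p) v) / (g p * g p))) (at p)" if "p \<in> S" for p
    by (rule has_derivative_divide'[OF jet_function_has_derivative[OF assms(2) that]
          jet_function_has_derivative[OF assms(3) that] assms(4)[OF that]])
  show "(frechet_derivative f (at p) (jet_unit j) * g p
      - f p * frechet_derivative g (at p) (jet_unit j)) / (g p * g p) = 0" if "p \<in> S" "m \<le> j" for p j
    using assms(2,3) that by (simp add: jet_function_dy_zero jet_dy_def[symmetric])
qed

lemma jet_function_sum:
  assumes "open S" "\<And>i. i \<in> I \<Longrightarrow> jet_function m S (f i)"
  shows "jet_function m S (\<lambda>p. \<Sum>i\<in>I. f i p)"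
  using assms(2)
  by (induction I rule: infinite_finite_induct)
    (auto intro: jet_function_add[OF assms(1)] jet_function_const)

lemma jet_function_yc: "open S \<Longrightarrow> j < m \<Longrightarrow> jet_function m S (yc j)"
  by (rule jet_functionI[OF _ bounded_linear_imp_has_derivative[OF bounded_linear_yc]])
    (auto simp: smooth_on_bounded_linear bounded_linear_yc yc_Pair_single)

lemma jet_function_frechet_derivative:
  assumes "open S" "jet_function m S f"
  shows "jet_function m S (\<lambda>p. frechet_derivative f (at p) v)"
  unfolding jet_function_def
proof (intro conjI ballI allI impI)
  show "smooth_on S (\<lambda>p. frechet_derivative f (at p) v)"
    by (rule smooth_on_frechet_derivative[OF jet_function_smooth[OF assms(2)]])
  fix p j assume p: "p \<in> S" and j: "m \<le> j"
  have "jet_dy j (\<lambda>p. frechet_derivative f (at p) v) p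
      = frechet_derivative (\<lambda>q. frechet_derivative f (at q) (jet_unit j)) (at p) v"
    unfolding jet_dy_def
    by (rule second_derivative_symmetric_real[OF assms(1) jet_function_smooth[OF assms(2)] p])
  also have "\<dots> = frechet_derivative (\<lambda>q. 0) (at p) v"
    by (rule frechet_derivative_transform_within_open[OF _ assms(1) p, THEN fun_cong])
      (simp_all add: jet_function_dy_zero[OF assms(2) _ j, unfolded jet_dy_def]
        smooth_on_differentiable[OF smooth_on_frechet_derivative[OF jet_function_smooth[OF assms(2)]] p])
  finally show "jet_dy j (\<lambda>p. frechet_derivative f (at p) v) p = 0" by simp
qed

lemma jet_function_dx: "open S \<Longrightarrow> jet_function m S f \<Longrightarrow> jet_function m S (jet_dx f)"
  unfolding jet_dx_def by (rule jet_function_frechet_derivative)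

lemma jet_function_dy: "open S \<Longrightarrow> jet_function m S f \<Longrightarrow> jet_function m S (jet_dy j f)"
  unfolding jet_dy_def by (rule jet_function_frechet_derivative)

lemma has_derivative_total_deriv:
  assumes "open S" "jet_function m S f" "p \<in> S"
  shows "(total_deriv f has_derivative
    (\<lambda>v. frechet_derivative (jet_dx f) (at p) v + (\<Sum>j<m. yc (Suc j) p *
      frechet_derivative (jet_dy j f) (at p) v + yc (Suc j) v * jet_dy j f p))) (at p)"
proof -
  have "((\<lambda>q. jet_dx f q + (\<Sum>j<m. yc (Suc j) q * jet_dy j f q)) has_derivative
    (\<lambda>v. frechet_derivative (jet_dx f) (at p) v + (\<Sum>j<m. yc (Suc j) p *
      frechet_derivative (jet_dy j f) (at p) v + yc (Suc j) v * jet_dy j f p))) (at p)"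
    by (intro has_derivative_add has_derivative_sum has_derivative_mult
        bounded_linear_imp_has_derivative[OF bounded_linear_yc])
      (rule jet_function_has_derivative[OF _ assms(3)] jet_function_dx jet_function_dy assms(1,2))+
  then show ?thesis
    by (rule has_derivative_transform_within_open[OF _ assms(1,3)])
      (simp add: total_deriv_eq[OF assms(2) _ order_refl])
qed

lemma frechet_derivative_total_deriv:
  assumes "open S" "jet_function m S f" "p \<in> S"
  shows "frechet_derivative (total_deriv f) (at p) v
    = total_deriv (\<lambda>q. frechet_derivative f (at q) v) p + (\<Sum>j<m. yc (Suc j) v * jet_dy j f p)"
proof -
  note sym = second_derivative_symmetric_real[OF assms(1) jet_function_smooth[OF assms(2)] assms(3)]
  show ?thesis
    using sym[of "(1, 0)" v] sym[of "jet_unit _" v]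
    by (simp add: frechet_derivative_eqI[OF has_derivative_total_deriv[OF assms]] sum.distrib
        total_deriv_eq[OF jet_function_frechet_derivative[OF assms(1,2)] assms(3) order_refl]
        jet_dx_def[abs_def] jet_dy_def[abs_def])
qed

text \<open>
  The commutator of \<open>\<partial>/\<partial>y\<^sup>(\<^sup>j\<^sup>)\<close> with \<open>D\<close> is \<open>\<partial>/\<partial>y\<^sup>(\<^sup>j\<^sup>-\<^sup>1\<^sup>)\<close>,
  and \<open>0\<close> for \<open>j = 0\<close>. On this relation rest
  both the commutation of evolutionary fields with \<open>D\<close> and the leading coefficient of \<open>D f\<close>.
\<close>

lemma jet_dy_total_deriv:
  assumes "open S" "jet_function m S f" "p \<in> S"
  shows "jet_dy j (total_deriv f) p
    = total_deriv (jet_dy j f) p + (if j = 0 then 0 else jet_dy (j - 1) f p)"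
proof -
  have yc: "yc (Suc i) (jet_unit j) = (if j = Suc i then 1 else 0)" for i
    by (rule yc_Pair_single)
  have "(\<Sum>i<m. yc (Suc i) (jet_unit j) * jet_dy i f p) = (if j = 0 then 0 else jet_dy (j - 1) f p)"
    unfolding yc
  proof (cases j)
    case (Suc j')
    have "(\<Sum>i<m. (if j = Suc i then 1 else 0) * jet_dy i f p)
        = (\<Sum>i<m. if i = j' then jet_dy i f p else 0)"
      using Suc by (intro sum.cong) auto
    also have "\<dots> = jet_dy j' f p"
      using jet_function_dy_zero[OF assms(2,3), of j'] by auto
    finally show "(\<Sum>i<m. (if j = Suc i then 1 else 0) * jet_dy i f p)
      = (if j = 0 then 0 else jet_dy (j - 1) f p)" using Suc by simp
  qed simp
  then show ?thesis
    using frechet_derivative_total_deriv[OF assms, of "jet_unit j"]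
    by (simp add: jet_dy_def[abs_def])
qed

lemma jet_function_total_deriv:
  assumes "open S" "jet_function m S f"
  shows "jet_function (Suc m) S (total_deriv f)"
proof (rule jet_function_cong[OF assms(1)])
  show "jet_function (Suc m) S (\<lambda>p. jet_dx f p + (\<Sum>j<m. yc (Suc j) p * jet_dy j f p))"
    by (intro jet_function_add[OF assms(1)] jet_function_sum[OF assms(1)]
        jet_function_mult[OF assms(1)] jet_function_yc[OF assms(1)]
        jet_function_dx[OF assms(1)] jet_function_dy[OF assms(1)]
        jet_function_mono[OF assms(2)]) auto
  show "jet_dx f p + (\<Sum>j<m. yc (Suc j) p * jet_dy j f p) = total_deriv f p" if "p \<in> S" for p
    by (simp add: total_deriv_eq[OF assms(2) that order_refl])
qed

lemma jet_function_funpow_total_deriv: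
  "open S \<Longrightarrow> jet_function m S f \<Longrightarrow> jet_function (m + j) S ((total_deriv ^^ j) f)"
  by (induction j) (simp_all add: jet_function_total_deriv)

section \<open>Evolutionary vector fields\<close>

text \<open>
  The evolutionary vector field with characteristic \<open>q\<close>, truncated at \<open>N\<close>; on functions of order at
  most \<open>N\<close> the truncation has no effect.
\<close>

definition evolution :: "nat \<Rightarrow> (jet \<Rightarrow> real) \<Rightarrow> (jet \<Rightarrow> real) \<Rightarrow> jet \<Rightarrow> real"
  where "evolution N q f p = (\<Sum>j<N. (total_deriv ^^ j) q p * jet_dy j f p)"

definition evolution_direction :: "nat \<Rightarrow> (jet \<Rightarrow> real) \<Rightarrow> jet \<Rightarrow> jet"
  where "evolution_direction N q p = (0, \<Sum>j<N. Poly_Mapping.single j ((total_deriv ^^ j) q p))"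

lemma evolution_direction_components:
  "fst (evolution_direction N q p) = 0"
  "yc j (evolution_direction N q p) = (if j < N then (total_deriv ^^ j) q p else 0)"
  by (simp_all add: evolution_direction_def yc_Pair_sum)

lemma evolution_frechet:
  assumes "jet_function m S f" "p \<in> S" "m \<le> N"
  shows "evolution N q f p = frechet_derivative f (at p) (evolution_direction N q p)"
  by (simp add: jet_function_derivative[OF assms] evolution_def evolution_direction_def
      yc_Pair_sum)

lemma jet_function_evolution:
  assumes "open S" "jet_function m S f" "jet_function r S q"
  shows "jet_function (m + r + N) S (evolution N q f)"
  unfolding evolution_def
  by (intro jet_function_sum[OF assms(1)] jet_function_mult[OF assms(1)]
      jet_function_mono[OF jet_function_funpow_total_deriv[OF assms(1,3)]]
      jet_function_mono[OF jet_function_dy[OF assms(1,2)]]) auto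

lemma total_deriv_mult:
  assumes "f differentiable (at p)" "g differentiable (at p)"
  shows "total_deriv (\<lambda>q. f q * g q) p = f p * total_deriv g p + total_deriv f p * g p"
proof -
  have "((\<lambda>q. f q * g q) has_derivative
    (\<lambda>v. f p * frechet_derivative g (at p) v + frechet_derivative f (at p) v * g p)) (at p)"
    by (intro has_derivative_mult has_derivative_frechet assms)
  then show ?thesis
    by (simp add: total_deriv_def jet_dx_def jet_dy_def frechet_derivative_eqI algebra_simps
        sum.distrib sum_distrib_left)
qed

lemma total_deriv_add:
  assumes "f differentiable (at p)" "g differentiable (at p)"
  shows "total_deriv (\<lambda>q. f q + g q) p = total_deriv f p + total_deriv g p"
proof -
  have "((\<lambda>q. f q + g q) has_derivative
    (\<lambda>v. frechet_derivative f (at p) v + frechet_derivative g (at p) v)) (at p)"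
    by (intro has_derivative_add has_derivative_frechet assms)
  then show ?thesis
    by (simp add: total_deriv_def jet_dx_def jet_dy_def frechet_derivative_eqI algebra_simps
        sum.distrib)
qed

lemma total_deriv_sum:
  assumes "open S" "finite I" "\<And>i. i \<in> I \<Longrightarrow> jet_function m S (f i)" "p \<in> S"
  shows "total_deriv (\<lambda>q. \<Sum>i\<in>I. f i q) p = (\<Sum>i\<in>I. total_deriv (f i) p)"
  using assms(2,3)
proof (induction I)
  case empty
  then show ?case by (simp add: total_deriv_def jet_dx_def jet_dy_def)
next
  case (insert i I)
  have "total_deriv (\<lambda>q. f i q + (\<Sum>i\<in>I. f i q)) p
      = total_deriv (f i) p + total_deriv (\<lambda>q. \<Sum>i\<in>I. f i q) p"
    using insert.prems
    by (intro total_deriv_add jet_function_differentiable[OF _ assms(4)]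
        jet_function_sum[OF assms(1)]) auto
  with insert show ?case by simp
qed

text \<open>
  Differentiating \<open>\<Sum>\<^sub>j (D\<^sup>j q) \<partial>f/\<partial>y\<^sup>(\<^sup>j\<^sup>)\<close> by \<open>D\<close> produces the additional terms
  \<open>(D\<^sup>j\<^sup>+\<^sup>1 q) \<partial>f/\<partial>y\<^sup>(\<^sup>j\<^sup>)\<close>; after an index shift they are the commutator terms from
  \<open>jet_dy_total_deriv\<close>.
\<close>

lemma evolution_total_deriv:
  assumes "open S" "jet_function m S f" "jet_function r S q" "m < N" "p \<in> S"
  shows "evolution N q (total_deriv f) p = total_deriv (evolution N q f) p"
proof -
  obtain N' where N: "N = Suc N'" using assms(4) by (cases N) auto
  define z where "z = (\<lambda>j. (total_deriv ^^ j) q)"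
  have z: "jet_function (r + j) S (z j)" for j
    unfolding z_def by (rule jet_function_funpow_total_deriv[OF assms(1,3)])
  have zSuc: "total_deriv (z j) = z (Suc j)" for j by (simp add: z_def)
  have dy: "jet_function m S (jet_dy j f)" for j by (rule jet_function_dy[OF assms(1,2)])
  have "evolution N q (total_deriv f) p
      = (\<Sum>j<N. z j p * total_deriv (jet_dy j f) p)
        + (\<Sum>j<N. z j p * (if j = 0 then 0 else jet_dy (j - 1) f p))"
    by (simp add: evolution_def z_def jet_dy_total_deriv[OF assms(1,2,5)] algebra_simps sum.distrib)
  also have "(\<Sum>j<N. z j p * (if j = 0 then 0 else jet_dy (j - 1) f p))
      = (\<Sum>j<N'. z (Suc j) p * jet_dy j f p)"
    unfolding N by (subst sum.lessThan_Suc_shift) simp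
  also have "\<dots> = (\<Sum>j<N. z (Suc j) p * jet_dy j f p)"
    using assms(4) jet_function_dy_zero[OF assms(2,5), of N'] by (simp add: N)
  also have "(\<Sum>j<N. z j p * total_deriv (jet_dy j f) p) + (\<Sum>j<N. z (Suc j) p * jet_dy j f p)
      = (\<Sum>j<N. total_deriv (\<lambda>p. z j p * jet_dy j f p) p)"
    by (simp add: total_deriv_mult[OF
          jet_function_differentiable[OF z assms(5)] jet_function_differentiable[OF dy assms(5)]] zSuc sum.distrib)
  also have "\<dots> = total_deriv (\<lambda>p. \<Sum>j<N. z j p * jet_dy j f p) p"
    by (rule total_deriv_sum[OF assms(1) _ _ assms(5), symmetric, where m = "m + r + N"])
      (auto intro!: jet_function_mult[OF assms(1)] jet_function_mono[OF z] jet_function_mono[OF dy])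
  finally show ?thesis by (simp add: evolution_def[abs_def] z_def)
qed

lemma evolution_mult:
  assumes "f differentiable (at p)" "g differentiable (at p)"
  shows "evolution N z (\<lambda>q. f q * g q) p = f p * evolution N z g p + evolution N z f p * g p"
proof -
  have "((\<lambda>q. f q * g q) has_derivative
    (\<lambda>v. f p * frechet_derivative g (at p) v + frechet_derivative f (at p) v * g p)) (at p)"
    by (intro has_derivative_mult has_derivative_frechet assms)
  then show ?thesis
    by (simp add: evolution_def jet_dy_def frechet_derivative_eqI algebra_simps
        sum.distrib sum_distrib_left)
qed

lemma evolution_cong:
  assumes "open S" "p \<in> S" "f differentiable (at p)" "\<And>q. q \<in> S \<Longrightarrow> f q = g q"
  shows "evolution N z f p = evolution N z g p"
  using frechet_derivative_transform_within_open[OF assms(3,1,2,4)]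
  by (simp add: evolution_def jet_dy_def)

lemma jet_dy_mult:
  assumes "f differentiable (at p)" "g differentiable (at p)"
  shows "jet_dy j (\<lambda>q. f q * g q) p = f p * jet_dy j g p + jet_dy j f p * g p"
  unfolding jet_dy_def
  by (rule frechet_derivative_eqI) (intro has_derivative_mult has_derivative_frechet assms)

text \<open>
  The leading coefficient of \<open>D f\<close> is that of \<open>f\<close>.
\<close>

lemma jet_dy_Suc_total_deriv_top:
  assumes "open S" "jet_function m S f" "m \<le> Suc j" "p \<in> S"
  shows "jet_dy (Suc j) (total_deriv f) p = jet_dy j f p"
proof -
  have "total_deriv (jet_dy (Suc j) f) p = total_deriv (\<lambda>q. 0) p"
    by (rule total_deriv_cong[OF assms(1,4)
          jet_function_differentiable[OF jet_function_dy[OF assms(1,2)] assms(4)]])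
      (rule jet_function_dy_zero[OF assms(2) _ assms(3)])
  also have "\<dots> = 0" by (simp add: total_deriv_def jet_dx_def jet_dy_def)
  finally show ?thesis by (simp add: jet_dy_total_deriv[OF assms(1,2,4)])
qed

section \<open>Functions of the first-order jet\<close>

lemma has_derivative_base_compose:
  assumes "smooth_on M f" "base p \<in> M"
  shows "((\<lambda>p. f (base p)) has_derivative (\<lambda>v. frechet_derivative f (at (base p)) (base v))) (at p)"
  by (rule has_derivative_compose[where g = f, OF
        bounded_linear_imp_has_derivative[OF bounded_linear_base]
        smooth_on_has_derivative[OF assms]])

lemma open_vimage_base: "open M \<Longrightarrow> open (base -` M)"
  by (rule continuous_open_vimage)
    (simp_all add: linear_continuous_at bounded_linear_base)

lemma jet_function_base_compose:
  assumes "open M" "smooth_on M f"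
  shows "jet_function 2 (base -` M) (\<lambda>p. f (base p))"
proof (rule jet_functionI[OF _ has_derivative_base_compose[OF assms(2)]])
  show "smooth_on (base -` M) (\<lambda>p. f (base p))"
    by (rule smooth_on_compose[OF open_vimage_base[OF assms(1)] assms(1) _ _ assms(2)])
      (auto intro: smooth_on_bounded_linear open_vimage_base assms(1) bounded_linear_base)
  show "frechet_derivative f (at (base p)) (base (jet_unit j)) = 0"
    if "p \<in> base -` M" "2 \<le> j" for p j
  proof -
    have "base (jet_unit j) = 0"
      using that(2) by (simp add: base_def yc_Pair_single zero_prod_def)
    with that(1) show ?thesis
      using linear_0[OF linear_frechet_derivative[OF smooth_on_differentiable[OF assms(2)]]] by simp
  qed
qed simp

text \<open>
  Over each jet, \<open>base\<close> has a continuous affine section through that jet.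
\<close>

lemma open_base_image:
  assumes "open U"
  shows "open (base ` U)"
proof -
  \<comment> \<open>The affine section through \<open>p\<close> is \<open>m \<mapsto> p + lift (m - base p)\<close>.\<close>
  define lift where "lift = (\<lambda>v::point. (fst v, fst (snd v) *\<^sub>R Poly_Mapping.single 0 1
    + snd (snd v) *\<^sub>R Poly_Mapping.single (1::nat) (1::real)))"
  have yc_lift: "yc j (lift v) = (if j = 0 then fst (snd v) else if j = 1 then snd (snd v) else 0)"
    for v j
    by (simp add: lift_def yc_def lookup_add lookup_scaleR lookup_single lookup_one when_def)
  have "\<exists>T. open T \<and> base p \<in> T \<and> T \<subseteq> base ` U" if "p \<in> U" for p
  proof (intro exI conjI)
    let ?s = "\<lambda>m. p + lift (m - base p)"
    have "continuous_on UNIV ?s"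
      unfolding lift_def by (intro continuous_intros)
    then show "open (?s -` U)" using assms by (simp add: open_vimage)
    have "lift (base p - base p) = 0" by (rule jet_eqI) (simp_all add: yc_lift, simp_all add: lift_def yc_def)
    then show "base p \<in> ?s -` U" using that by simp
    have "base (?s m) = m" for m
      by (simp add: base_def yc_add yc_lift prod_eq_iff) (simp add: lift_def)
    then show "?s -` U \<subseteq> base ` U" by (metis image_eqI subsetI vimageD)
  qed
  then show ?thesis by (subst open_subopen) blast
qed

section \<open>Contact transformations and their action on vector fields\<close>

lemma frechet_derivative_d3:
  fixes f :: "point \<Rightarrow> real"
  assumes "f differentiable (at m)"
  shows "frechet_derivative f (at m) v
    = fst v * d3x f m + fst (snd v) * d3y f m + snd (snd v) * d3y1 f m"
proof -
  note lin = linear_frechet_derivative[OF assms]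
  have "v = fst v *\<^sub>R (1, 0, 0) + fst (snd v) *\<^sub>R (0, 1, 0) + snd (snd v) *\<^sub>R (0, 0, 1)"
    by (simp add: prod_eq_iff)
  then have "frechet_derivative f (at m) v = frechet_derivative f (at m)
      (fst v *\<^sub>R (1, 0, 0) + fst (snd v) *\<^sub>R (0, 1, 0) + snd (snd v) *\<^sub>R (0, 0, 1))" by simp
  also have "\<dots> = fst v *\<^sub>R d3x f m + fst (snd v) *\<^sub>R d3y f m + snd (snd v) *\<^sub>R d3y1 f m"
    unfolding d3x_def d3y_def d3y1_def by (simp only: linear_add[OF lin] linear_cmul[OF lin])
  finally show ?thesis by simp
qed

lemma smooth_on_char_field:
  assumes "open M" "smooth_on M Q"
  shows "smooth_on M (char_field M Q)"
proof (rule smooth_on_cong[OF assms(1)])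
  have y1: "smooth_on M (\<lambda>m::point. snd (snd m))"
    by (rule smooth_on_bounded_linear[OF assms(1)]) (intro bounded_linear_snd_comp bounded_linear_snd)
  have neg: "smooth_on M (\<lambda>m. 0 - d3y1 Q m)"
    unfolding d3y1_def
    by (intro smooth_on_diff smooth_on_const smooth_on_frechet_derivative assms)
  show "smooth_on M (\<lambda>m. (0 - d3y1 Q m, Q m - snd (snd m) * d3y1 Q m,
      d3x Q m + snd (snd m) * d3y Q m))"
    by (intro smooth_on_Pair neg assms smooth_on_add smooth_on_diff smooth_on_mult y1)
      (unfold d3x_def d3y_def d3y1_def, (rule smooth_on_frechet_derivative assms)+)
qed (simp add: char_field_def Let_def)

text \<open>
  The data of a uniform contact transformation with its witnesses fixed. Openness of \<open>M\<close> is part of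
  the locale; for the space of points below an open set of jets it follows from
  \<open>open_base_image\<close>.
\<close>

locale contact_transformation =
  fixes M :: "point set" and \<Gamma> :: "point \<Rightarrow> point" and k :: real
    and \<Phi> \<Theta> \<Psi> :: "real \<times> real \<Rightarrow> real"
  assumes open_M: "open M" and diffeo: "diffeomorphism_on M \<Gamma>" and k_nonzero: "k \<noteq> 0"
    and smooth_\<Phi>: "smooth_on (xy1_proj M) \<Phi>"
    and smooth_\<Theta>: "smooth_on (xy1_proj M) \<Theta>"
    and smooth_\<Psi>: "smooth_on (xy1_proj M) \<Psi>"
    and \<Gamma>_eq: "\<And>x y y1. (x, y, y1) \<in> M \<Longrightarrow> \<Gamma> (x, y, y1) = (\<Phi> (x, y1), k * y + \<Theta> (x, y1), \<Psi> (x, y1))"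
    and contact_x: "\<And>x y1. (x, y1) \<in> xy1_proj M \<Longrightarrow>
      k * y1 + frechet_derivative \<Theta> (at (x, y1)) (1, 0)
        = frechet_derivative \<Phi> (at (x, y1)) (1, 0) * \<Psi> (x, y1)"
    and contact_y1: "\<And>x y1. (x, y1) \<in> xy1_proj M \<Longrightarrow>
      frechet_derivative \<Theta> (at (x, y1)) (0, 1)
        = frechet_derivative \<Phi> (at (x, y1)) (0, 1) * \<Psi> (x, y1)"
begin

abbreviation dx :: "(real \<times> real \<Rightarrow> real) \<Rightarrow> real \<times> real \<Rightarrow> real"
  where "dx f z \<equiv> frechet_derivative f (at z) (1, 0)"

abbreviation dy1 :: "(real \<times> real \<Rightarrow> real) \<Rightarrow> real \<times> real \<Rightarrow> real"
  where "dy1 f z \<equiv> frechet_derivative f (at z) (0, 1)"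

abbreviation proj :: "point \<Rightarrow> real \<times> real"
  where "proj m \<equiv> (fst m, snd (snd m))"

lemma xy1_proj_eq: "xy1_proj M = proj ` M"
  by (force simp: xy1_proj_def)

lemma proj_mem: "m \<in> M \<Longrightarrow> proj m \<in> xy1_proj M"
  by (auto simp: xy1_proj_eq)

lemma bounded_linear_proj: "bounded_linear proj"
  by (intro bounded_linear_Pair bounded_linear_fst bounded_linear_snd_comp bounded_linear_snd)

lemma open_xy1_proj: "open (xy1_proj M)"
proof -
  have "\<exists>T. open T \<and> proj m \<in> T \<and> T \<subseteq> proj ` M" if "m \<in> M" for m
  proof (intro exI conjI)
    let ?s = "\<lambda>z::real \<times> real. (fst z, fst (snd m), snd z)"
    have "continuous_on UNIV ?s" by (intro continuous_intros)
    then show "open (?s -` M)" using open_M by (simp add: open_vimage)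
    show "proj m \<in> ?s -` M" using that by simp
    show "?s -` M \<subseteq> proj ` M" by force
  qed
  then show ?thesis unfolding xy1_proj_eq by (subst open_subopen) blast
qed

lemma \<Gamma>_mem: "m \<in> M \<Longrightarrow> \<Gamma> m \<in> M"
  using diffeo by (auto simp: diffeomorphism_on_def bij_betw_def)

lemma smooth_\<Gamma>: "smooth_on M \<Gamma>"
  using diffeo by (simp add: diffeomorphism_on_def)

lemma \<Gamma>_eq': "m \<in> M \<Longrightarrow>
    \<Gamma> m = (\<Phi> (proj m), k * fst (snd m) + \<Theta> (proj m), \<Psi> (proj m))"
  using \<Gamma>_eq[of "fst m" "fst (snd m)" "snd (snd m)"] by simp

lemma contact_x': "z \<in> xy1_proj M \<Longrightarrow> dx \<Theta> z = dx \<Phi> z * \<Psi> z - k * snd z"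
  using contact_x[of "fst z" "snd z"] by simp

lemma contact_y1': "z \<in> xy1_proj M \<Longrightarrow> dy1 \<Theta> z = dy1 \<Phi> z * \<Psi> z"
  using contact_y1[of "fst z" "snd z"] by simp

lemma derivative_proj:
  assumes "smooth_on (xy1_proj M) f" "m \<in> M"
  shows "((\<lambda>m. f (proj m)) has_derivative
    (\<lambda>v. fst v * dx f (proj m) + snd (snd v) * dy1 f (proj m))) (at m)"
proof -
  have d: "f differentiable (at (proj m))"
    by (rule smooth_on_differentiable[OF assms(1) proj_mem[OF assms(2)]])
  have expand: "frechet_derivative f (at (proj m)) (a, b) = a * dx f (proj m) + b * dy1 f (proj m)" for a b
  proof -
    have "frechet_derivative f (at (proj m)) (a, b)
        = frechet_derivative f (at (proj m)) (a *\<^sub>R (1, 0) + b *\<^sub>R (0, 1))" by simp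
    also have "\<dots> = a *\<^sub>R dx f (proj m) + b *\<^sub>R dy1 f (proj m)"
      by (simp only: linear_add[OF linear_frechet_derivative[OF d]]
          linear_cmul[OF linear_frechet_derivative[OF d]])
    finally show ?thesis by simp
  qed
  have eq: "(\<lambda>v. frechet_derivative f (at (proj m)) (proj v))
      = (\<lambda>v. fst v * dx f (proj m) + snd (snd v) * dy1 f (proj m))"
    by (rule ext) (rule expand)
  have "((\<lambda>m. f (proj m)) has_derivative
      (\<lambda>v. frechet_derivative f (at (proj m)) (proj v))) (at m)"
    by (rule has_derivative_compose[where g = f, OF
          bounded_linear_imp_has_derivative[OF bounded_linear_proj] has_derivative_frechet[OF d]])
  then show ?thesis unfolding eq .
qed

lemma derivative_\<Gamma>:
  assumes "m \<in> M"
  shows "frechet_derivative \<Gamma> (at m) v =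
    (fst v * dx \<Phi> (proj m) + snd (snd v) * dy1 \<Phi> (proj m),
     k * fst (snd v) + (fst v * dx \<Theta> (proj m) + snd (snd v) * dy1 \<Theta> (proj m)),
     fst v * dx \<Psi> (proj m) + snd (snd v) * dy1 \<Psi> (proj m))"
proof (rule frechet_derivative_eqI)
  have "((\<lambda>m. (\<Phi> (proj m), k * fst (snd m) + \<Theta> (proj m), \<Psi> (proj m))) has_derivative (\<lambda>v.
      (fst v * dx \<Phi> (proj m) + snd (snd v) * dy1 \<Phi> (proj m),
       k * fst (snd v) + (fst v * dx \<Theta> (proj m) + snd (snd v) * dy1 \<Theta> (proj m)),
       fst v * dx \<Psi> (proj m) + snd (snd v) * dy1 \<Psi> (proj m)))) (at m)"
    by (intro has_derivative_Pair has_derivative_add derivative_proj assms smooth_\<Phi> smooth_\<Theta>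
        smooth_\<Psi> has_derivative_mult_right has_derivative_fst has_derivative_snd has_derivative_ident)
  then show "(\<Gamma> has_derivative (\<lambda>v.
      (fst v * dx \<Phi> (proj m) + snd (snd v) * dy1 \<Phi> (proj m),
       k * fst (snd v) + (fst v * dx \<Theta> (proj m) + snd (snd v) * dy1 \<Theta> (proj m)),
       fst v * dx \<Psi> (proj m) + snd (snd v) * dy1 \<Psi> (proj m)))) (at m)"
    by (rule has_derivative_transform_within_open[OF _ open_M assms]) (simp add: \<Gamma>_eq')
qed

text \<open>
  Differentiate the first contact condition by \<open>y'\<close> and the second one by \<open>x\<close>, and subtract: the
  mixed second derivatives of \<open>\<Theta>\<close> and \<open>\<Phi>\<close> cancel, and \<open>k\<close> remains.
\<close>

lemma jacobian:
  assumes z: "z \<in> xy1_proj M"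
  shows "dx \<Phi> z * dy1 \<Psi> z - dy1 \<Phi> z * dx \<Psi> z = k"
proof -
  note d = smooth_on_has_derivative[OF _ z]
  note d1 = d[OF smooth_on_frechet_derivative]
  have "((\<lambda>z. dx \<Phi> z * \<Psi> z - k * snd z) has_derivative (\<lambda>v.
      dx \<Phi> z * frechet_derivative \<Psi> (at z) v + frechet_derivative (dx \<Phi>) (at z) v * \<Psi> z
        - k * snd v)) (at z)"
    by (intro has_derivative_diff has_derivative_mult has_derivative_mult_right has_derivative_snd
        has_derivative_ident d[OF smooth_\<Psi>] d1[OF smooth_\<Phi>])
  then have "(dx \<Theta> has_derivative (\<lambda>v.
      dx \<Phi> z * frechet_derivative \<Psi> (at z) v + frechet_derivative (dx \<Phi>) (at z) v * \<Psi> z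
        - k * snd v)) (at z)"
    by (rule has_derivative_transform_within_open[OF _ open_xy1_proj z]) (simp add: contact_x')
  then have 1: "dy1 (dx \<Theta>) z = dx \<Phi> z * dy1 \<Psi> z + dy1 (dx \<Phi>) z * \<Psi> z - k"
    by (simp add: frechet_derivative_eqI)
  have "((\<lambda>z. dy1 \<Phi> z * \<Psi> z) has_derivative (\<lambda>v.
      dy1 \<Phi> z * frechet_derivative \<Psi> (at z) v + frechet_derivative (dy1 \<Phi>) (at z) v * \<Psi> z)) (at z)"
    by (intro has_derivative_mult d[OF smooth_\<Psi>] d1[OF smooth_\<Phi>])
  then have "(dy1 \<Theta> has_derivative (\<lambda>v.
      dy1 \<Phi> z * frechet_derivative \<Psi> (at z) v + frechet_derivative (dy1 \<Phi>) (at z) v * \<Psi> z)) (at z)"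
    by (rule has_derivative_transform_within_open[OF _ open_xy1_proj z]) (simp add: contact_y1')
  then have 2: "dx (dy1 \<Theta>) z = dy1 \<Phi> z * dx \<Psi> z + dx (dy1 \<Phi>) z * \<Psi> z"
    by (simp add: frechet_derivative_eqI)
  have "dy1 (dx \<Theta>) z = dx (dy1 \<Theta>) z" "dy1 (dx \<Phi>) z = dx (dy1 \<Phi>) z"
    by (rule second_derivative_symmetric_real[OF open_xy1_proj _ z], fact smooth_\<Theta> smooth_\<Phi>)+
  with 1 2 show ?thesis by simp
qed

lemma inj_derivative_\<Gamma>:
  assumes m: "m \<in> M"
  shows "inj (frechet_derivative \<Gamma> (at m))"
proof -
  have lin: "linear (frechet_derivative \<Gamma> (at m))"
    by (rule linear_frechet_derivative[OF smooth_on_differentiable[OF smooth_\<Gamma> m]])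
  have "v = 0" if "frechet_derivative \<Gamma> (at m) v = 0" for v
  proof -
    note z = proj_mem[OF m]
    have 1: "fst v * dx \<Phi> (proj m) + snd (snd v) * dy1 \<Phi> (proj m) = 0"
      and 2: "k * fst (snd v) + (fst v * dx \<Theta> (proj m) + snd (snd v) * dy1 \<Theta> (proj m)) = 0"
      and 3: "fst v * dx \<Psi> (proj m) + snd (snd v) * dy1 \<Psi> (proj m) = 0"
      using that by (simp_all add: derivative_\<Gamma>[OF m] zero_prod_def)
    have "fst v * k = 0" "snd (snd v) * k = 0"
      using 1 3 unfolding jacobian[OF z, symmetric] by algebra+
    with k_nonzero 2 show ?thesis by (simp add: prod_eq_iff)
  qed
  then show ?thesis by (simp add: linear_injective_0[OF lin])
qed

lemma pullback_eqI:
  assumes "m \<in> M" "frechet_derivative \<Gamma> (at m) v = X (\<Gamma> m)"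
  shows "pullback M \<Gamma> X m = v"
proof -
  have "(THE v. frechet_derivative \<Gamma> (at m) v = X (\<Gamma> m)) = v"
  proof (rule the_equality[where P = "\<lambda>v. frechet_derivative \<Gamma> (at m) v = X (\<Gamma> m)", OF assms(2)])
    fix u assume "frechet_derivative \<Gamma> (at m) u = X (\<Gamma> m)"
    then have "frechet_derivative \<Gamma> (at m) u = frechet_derivative \<Gamma> (at m) v"
      by (simp only: assms(2))
    then show "u = v" by (rule injD[OF inj_derivative_\<Gamma>[OF assms(1)]])
  qed
  with assms(1) show ?thesis by (simp add: pullback_def)
qed

lemma derivative_pullback:
  assumes m: "m \<in> M"
  shows "frechet_derivative \<Gamma> (at m) (pullback M \<Gamma> X m) = X (\<Gamma> m)"
proof -
  have "linear (frechet_derivative \<Gamma> (at m))"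
    by (rule linear_frechet_derivative[OF smooth_on_differentiable[OF smooth_\<Gamma> m]])
  then have "surj (frechet_derivative \<Gamma> (at m))"
    by (rule linear_inj_imp_surj[OF _ inj_derivative_\<Gamma>[OF m]])
  then obtain v where v: "frechet_derivative \<Gamma> (at m) v = X (\<Gamma> m)" by (metis surjD)
  have "pullback M \<Gamma> X m = v" by (rule pullback_eqI[OF m]) (rule v)
  then show ?thesis by (simp only: v)
qed

lemma linear_pullback: "linear (pullback M \<Gamma>)"
proof (rule linearI)
  fix X Y :: vfield and r :: real
  have lin: "linear (frechet_derivative \<Gamma> (at m))" if "m \<in> M" for m
    by (rule linear_frechet_derivative[OF smooth_on_differentiable[OF smooth_\<Gamma> that]])
  show "pullback M \<Gamma> (X + Y) = pullback M \<Gamma> X + pullback M \<Gamma> Y"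
  proof
    show "pullback M \<Gamma> (X + Y) m = (pullback M \<Gamma> X + pullback M \<Gamma> Y) m" for m
    proof (cases "m \<in> M")
      case True
      show ?thesis
        by (rule pullback_eqI[OF True]) (simp add: linear_add[OF lin[OF True]] derivative_pullback[OF True])
    qed (simp add: pullback_def)
  qed
  show "pullback M \<Gamma> (r *\<^sub>R X) = r *\<^sub>R pullback M \<Gamma> X"
  proof
    show "pullback M \<Gamma> (r *\<^sub>R X) m = (r *\<^sub>R pullback M \<Gamma> X) m" for m
    proof (cases "m \<in> M")
      case True
      show ?thesis
        by (rule pullback_eqI[OF True])
          (simp add: linear_cmul[OF lin[OF True]] derivative_pullback[OF True] scaleR_fun_def)
    qed (simp add: pullback_def scaleR_fun_def)
  qed
qed

text \<open>
  Injectivity needs agreement outside \<open>M\<close>, because the pull-back only sees values on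
  \<open>\<Gamma> ` M = M\<close>. Elements of \<open>\<L>\<close> vanish there.
\<close>

lemma pullback_injective:
  assumes "pullback M \<Gamma> X = pullback M \<Gamma> Y" "\<And>m. m \<notin> M \<Longrightarrow> X m = Y m"
  shows "X = Y"
proof
  fix m
  show "X m = Y m"
  proof (cases "m \<in> M")
    case True
    have "\<Gamma> ` M = M" using diffeo by (simp add: diffeomorphism_on_def bij_betw_def)
    with True obtain m' where m': "m' \<in> M" "m = \<Gamma> m'" by (metis imageE)
    show ?thesis
      using derivative_pullback[OF m'(1), of X] derivative_pullback[OF m'(1), of Y]
      by (simp only: assms(1) m'(2))
  qed (rule assms(2))
qed

text \<open>
  Let \<open>Z'\<close> be the pull-back of \<open>Z\<close>. Differentiating \<open>d\<Gamma>(Z') = Z \<circ> \<Gamma>\<close> gives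
  \<open>d\<Gamma>(dZ' v) = dZ(d\<Gamma> v) - d\<^sup>2\<Gamma>(v, Z')\<close>. In the bracket the terms with \<open>d\<^sup>2\<Gamma>\<close> cancel by symmetry.
\<close>

lemma pullback_lie_bracket:
  assumes X: "smooth_on M X" "smooth_on M (pullback M \<Gamma> X)"
    and Y: "smooth_on M Y" "smooth_on M (pullback M \<Gamma> Y)"
  shows "pullback M \<Gamma> (lie_bracket M X Y) = lie_bracket M (pullback M \<Gamma> X) (pullback M \<Gamma> Y)"
proof
  fix m
  show "pullback M \<Gamma> (lie_bracket M X Y) m
    = lie_bracket M (pullback M \<Gamma> X) (pullback M \<Gamma> Y) m"
  proof (cases "m \<in> M")
    case m: True
    let ?d = "\<lambda>v m. frechet_derivative \<Gamma> (at m) v"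
    have lin: "linear (frechet_derivative \<Gamma> (at m))" if "m \<in> M" for m
      by (rule linear_frechet_derivative[OF smooth_on_differentiable[OF smooth_\<Gamma> that]])
    have key: "?d (frechet_derivative (pullback M \<Gamma> Z) (at m) v) m
        = frechet_derivative Z (at (\<Gamma> m)) (?d v m)
          - frechet_derivative (?d v) (at m) (pullback M \<Gamma> Z m)"
      if Z: "smooth_on M Z" "smooth_on M (pullback M \<Gamma> Z)" for Z v
    proof -
      let ?Z = "pullback M \<Gamma> Z"
      have expand: "?d (?Z q) q = (\<Sum>b\<in>Basis. (?Z q \<bullet> b) *\<^sub>R ?d b q)" if "q \<in> M" for q
        by (rule linear_euclidean_expand[OF lin[OF that]])
      have "((\<lambda>q. \<Sum>b\<in>Basis. (?Z q \<bullet> b) *\<^sub>R ?d b q) has_derivative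
        (\<lambda>v. \<Sum>b\<in>Basis. (?Z m \<bullet> b) *\<^sub>R frechet_derivative (?d b) (at m) v
          + (frechet_derivative ?Z (at m) v \<bullet> b) *\<^sub>R ?d b m)) (at m)"
        by (intro has_derivative_sum has_derivative_scaleR has_derivative_inner_left
            smooth_on_has_derivative[OF _ m] smooth_on_frechet_derivative smooth_\<Gamma> Z(2))
      then have a: "((\<lambda>q. Z (\<Gamma> q)) has_derivative
        (\<lambda>v. \<Sum>b\<in>Basis. (?Z m \<bullet> b) *\<^sub>R frechet_derivative (?d b) (at m) v
          + (frechet_derivative ?Z (at m) v \<bullet> b) *\<^sub>R ?d b m)) (at m)"
        by (rule has_derivative_transform_within_open[OF _ open_M m])
          (simp add: expand[symmetric] derivative_pullback)
      have b: "((\<lambda>q. Z (\<Gamma> q)) has_derivative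
          (\<lambda>v. frechet_derivative Z (at (\<Gamma> m)) (?d v m))) (at m)"
        by (rule has_derivative_compose[where g = Z, OF smooth_on_has_derivative[OF smooth_\<Gamma> m]
              smooth_on_has_derivative[OF Z(1) \<Gamma>_mem[OF m]]])
      have "frechet_derivative Z (at (\<Gamma> m)) (?d v m)
          = (\<Sum>b\<in>Basis. (?Z m \<bullet> b) *\<^sub>R frechet_derivative (?d b) (at m) v
            + (frechet_derivative ?Z (at m) v \<bullet> b) *\<^sub>R ?d b m)"
        by (rule fun_cong[OF has_derivative_unique[OF b a]])
      also have "\<dots> = (\<Sum>b\<in>Basis. (?Z m \<bullet> b) *\<^sub>R frechet_derivative (?d v) (at m) b)
          + (\<Sum>b\<in>Basis. (frechet_derivative ?Z (at m) v \<bullet> b) *\<^sub>R ?d b m)"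
        by (simp add: sum.distrib second_derivative_symmetric[OF open_M smooth_\<Gamma> m, of _ v])
      also have "(\<Sum>b\<in>Basis. (?Z m \<bullet> b) *\<^sub>R frechet_derivative (?d v) (at m) b)
          = frechet_derivative (?d v) (at m) (?Z m)"
        by (rule linear_euclidean_expand[symmetric, OF linear_frechet_derivative[OF
                smooth_on_differentiable[OF smooth_on_frechet_derivative[OF smooth_\<Gamma>] m]]])
      also have "(\<Sum>b\<in>Basis. (frechet_derivative ?Z (at m) v \<bullet> b) *\<^sub>R ?d b m)
          = ?d (frechet_derivative ?Z (at m) v) m"
        by (rule linear_euclidean_expand[symmetric, OF lin[OF m]])
      finally show ?thesis by simp
    qed
    have sym: "frechet_derivative (?d u) (at m) v = frechet_derivative (?d v) (at m) u" for u v
      by (rule second_derivative_symmetric[OF open_M smooth_\<Gamma> m])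
    have "?d (lie_bracket M (pullback M \<Gamma> X) (pullback M \<Gamma> Y) m) m = lie_bracket M X Y (\<Gamma> m)"
      using m \<Gamma>_mem[OF m]
      by (simp add: lie_bracket_def linear_diff[OF lin[OF m]] key[OF X] key[OF Y]
          derivative_pullback[OF m] sym[of "pullback M \<Gamma> X m" "pullback M \<Gamma> Y m"])
    then show ?thesis by (rule pullback_eqI[OF m])
  qed (simp add: pullback_def lie_bracket_def)
qed

text \<open>
  Comparing the partial derivatives of the two sides of \<open>k Q' = Q \<circ> \<Gamma>\<close>, multiplied by the entries of
  \<open>d\<Gamma>\<close>, reduces each component to the contact conditions and to the value \<open>k\<close> of the Jacobian. The
  \<open>x\<close>-component is also the relation between \<open>\<mu>\<close> and \<open>Q'\<close> used in \<open>evolution_x_hat\<close>.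
\<close>

lemma
  assumes Q: "smooth_on M Q" and Q': "smooth_on M Q'"
    and rel: "\<And>m. m \<in> M \<Longrightarrow> k * Q' m = Q (\<Gamma> m)" and m: "m \<in> M"
  shows characteristic_x: "dy1 \<Phi> (proj m) * (d3x Q' m + snd (snd m) * d3y Q' m)
      - dx \<Phi> (proj m) * d3y1 Q' m = - d3y1 Q (\<Gamma> m)"
    and derivative_\<Gamma>_char_field:
      "frechet_derivative \<Gamma> (at m) (char_field M Q' m) = char_field M Q (\<Gamma> m)"
proof -
  note z = proj_mem[OF m]
  let ?v = "frechet_derivative \<Gamma> (at m)"
  have "((\<lambda>m. k * Q' m) has_derivative (\<lambda>v. k * frechet_derivative Q' (at m) v)) (at m)"
    by (intro has_derivative_mult_right smooth_on_has_derivative[OF Q' m])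
  then have a: "((\<lambda>m. Q (\<Gamma> m)) has_derivative (\<lambda>v. k * frechet_derivative Q' (at m) v)) (at m)"
    by (rule has_derivative_transform_within_open[OF _ open_M m]) (simp add: rel)
  have b: "((\<lambda>m. Q (\<Gamma> m)) has_derivative (\<lambda>v. frechet_derivative Q (at (\<Gamma> m)) (?v v))) (at m)"
    by (rule has_derivative_compose[where g = Q, OF smooth_on_has_derivative[OF smooth_\<Gamma> m]
          smooth_on_has_derivative[OF Q \<Gamma>_mem[OF m]]])
  have rel': "k * frechet_derivative Q' (at m) v = frechet_derivative Q (at (\<Gamma> m)) (?v v)" for v
    by (rule fun_cong[OF has_derivative_unique[OF a b]])
  note Qd = frechet_derivative_d3[OF smooth_on_differentiable[OF Q \<Gamma>_mem[OF m]]]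
  have rx: "k * d3x Q' m = dx \<Phi> (proj m) * d3x Q (\<Gamma> m) + dx \<Theta> (proj m) * d3y Q (\<Gamma> m)
      + dx \<Psi> (proj m) * d3y1 Q (\<Gamma> m)"
    using rel'[of "(1, 0, 0)"] by (simp add: d3x_def[symmetric] Qd derivative_\<Gamma>[OF m])
  have ry: "k * d3y Q' m = k * d3y Q (\<Gamma> m)"
    using rel'[of "(0, 1, 0)"] by (simp add: d3y_def[symmetric] Qd derivative_\<Gamma>[OF m])
  have ry1: "k * d3y1 Q' m = dy1 \<Phi> (proj m) * d3x Q (\<Gamma> m) + dy1 \<Theta> (proj m) * d3y Q (\<Gamma> m)
      + dy1 \<Psi> (proj m) * d3y1 Q (\<Gamma> m)"
    using rel'[of "(0, 0, 1)"] by (simp add: d3y1_def[symmetric] Qd derivative_\<Gamma>[OF m])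
  note J = jacobian[OF z] and c1 = contact_x'[OF z, simplified] and c2 = contact_y1'[OF z]
  have "k * (dy1 \<Phi> (proj m) * (d3x Q' m + snd (snd m) * d3y Q' m)
      - dx \<Phi> (proj m) * d3y1 Q' m) = k * (- d3y1 Q (\<Gamma> m))"
    using rx ry ry1 J c1 c2 by algebra
  then show 1: "dy1 \<Phi> (proj m) * (d3x Q' m + snd (snd m) * d3y Q' m)
      - dx \<Phi> (proj m) * d3y1 Q' m = - d3y1 Q (\<Gamma> m)"
    by (simp only: mult_left_cancel[OF k_nonzero])
  have "k * (dy1 \<Psi> (proj m) * (d3x Q' m + snd (snd m) * d3y Q' m)
      - dx \<Psi> (proj m) * d3y1 Q' m) = k * (d3x Q (\<Gamma> m) + \<Psi> (proj m) * d3y Q (\<Gamma> m))"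
    using rx ry ry1 J c1 c2 by algebra
  then have 3: "dy1 \<Psi> (proj m) * (d3x Q' m + snd (snd m) * d3y Q' m)
      - dx \<Psi> (proj m) * d3y1 Q' m = d3x Q (\<Gamma> m) + \<Psi> (proj m) * d3y Q (\<Gamma> m)"
    by (simp only: mult_left_cancel[OF k_nonzero])
  have 2: "k * (Q' m - snd (snd m) * d3y1 Q' m) + (- d3y1 Q' m * dx \<Theta> (proj m)
      + (d3x Q' m + snd (snd m) * d3y Q' m) * dy1 \<Theta> (proj m)) = Q (\<Gamma> m) - \<Psi> (proj m) * d3y1 Q (\<Gamma> m)"
    using 1 rel[OF m] c1 c2 by algebra
  have \<Psi>: "snd (snd (\<Gamma> m)) = \<Psi> (proj m)" by (simp add: \<Gamma>_eq'[OF m])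
  show "frechet_derivative \<Gamma> (at m) (char_field M Q' m) = char_field M Q (\<Gamma> m)"
    using 1 2 3
    by (simp add: derivative_\<Gamma>[OF m] char_field_def m \<Gamma>_mem[OF m] \<Psi> Let_def algebra_simps)
qed

lemma pullback_char_field:
  assumes "smooth_on M Q" "smooth_on M Q'" "\<And>m. m \<in> M \<Longrightarrow> k * Q' m = Q (\<Gamma> m)"
  shows "pullback M \<Gamma> (char_field M Q) = char_field M Q'"
proof
  show "pullback M \<Gamma> (char_field M Q) m = char_field M Q' m" for m
  proof (cases "m \<in> M")
    case True
    then show ?thesis by (intro pullback_eqI derivative_\<Gamma>_char_field[OF assms])
  qed (simp add: pullback_def char_field_def)
qed

lemma smooth_on_affine_characteristic:
  assumes "smooth_on (xy1_proj M) \<phi>"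
  shows "smooth_on M (\<lambda>(x, y, y1). c * y + \<phi> (x, y1))"
proof -
  have "smooth_on M (\<lambda>m. \<phi> (proj m))"
    by (rule smooth_on_compose[OF open_M open_xy1_proj proj_mem _ assms])
      (auto intro: smooth_on_bounded_linear[OF open_M bounded_linear_proj])
  moreover have "smooth_on M (\<lambda>m. c * fst (snd m))"
    by (rule smooth_on_bounded_linear[OF open_M])
      (intro bounded_linear_const_mult bounded_linear_fst_comp bounded_linear_snd)
  ultimately have "smooth_on M (\<lambda>m. c * fst (snd m) + \<phi> (proj m))"
    by (intro smooth_on_add open_M)
  then show ?thesis by (simp add: case_prod_unfold)
qed

text \<open>
  The part of \<open>(Q \<circ> \<Gamma>) / k\<close> that depends on \<open>(x, y')\<close> only, for \<open>Q = c y + \<phi>(x, y')\<close>; the remaining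
  part is \<open>c y\<close>.
\<close>

definition pulled_part :: "real \<Rightarrow> (real \<times> real \<Rightarrow> real) \<Rightarrow> real \<times> real \<Rightarrow> real"
  where "pulled_part c \<phi> z = (c * \<Theta> z + \<phi> (\<Phi> z, \<Psi> z)) / k"

lemma smooth_on_pulled_part:
  assumes "smooth_on (xy1_proj M) \<phi>"
  shows "smooth_on (xy1_proj M) (pulled_part c \<phi>)"
proof -
  have mem: "(\<Phi> z, \<Psi> z) \<in> xy1_proj M" if "z \<in> xy1_proj M" for z
  proof -
    from that obtain m where "m \<in> M" "z = proj m" unfolding xy1_proj_eq by blast
    then show ?thesis using proj_mem[OF \<Gamma>_mem, of m] \<Gamma>_eq'[of m] by simp
  qed
  have "smooth_on (xy1_proj M) (\<lambda>z. \<phi> (\<Phi> z, \<Psi> z))"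
    by (rule smooth_on_compose[OF open_xy1_proj open_xy1_proj mem _ assms])
      (auto intro: smooth_on_Pair open_xy1_proj smooth_\<Phi> smooth_\<Psi>)
  then show ?thesis unfolding pulled_part_def[abs_def]
    by (intro smooth_on_divide smooth_on_add smooth_on_mult smooth_on_const open_xy1_proj
        smooth_\<Theta> k_nonzero)
qed

lemma pulled_part_relation:
  assumes "m \<in> M"
  shows "k * (case m of (x, y, y1) \<Rightarrow> c * y + pulled_part c \<phi> (x, y1))
    = (case \<Gamma> m of (x, y, y1) \<Rightarrow> c * y + \<phi> (x, y1))"
  using k_nonzero
  by (simp add: case_prod_unfold \<Gamma>_eq'[OF assms] pulled_part_def field_simps)

end

section \<open>Prolongation of a contact transformation\<close>

lemma yc_prolong: "yc j (prolong N \<Gamma> p) = (if j < N then y_hat \<Gamma> j p else 0)"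
  by (simp add: prolong_def yc_Pair_sum)

lemma fst_prolong: "fst (prolong N \<Gamma> p) = x_hat \<Gamma> p"
  by (simp add: prolong_def)

context contact_transformation
begin

definition regular_jets :: "jet set"
  where "regular_jets = {p. base p \<in> M \<and> total_deriv (x_hat \<Gamma>) p \<noteq> 0}"

lemma open_over_M: "open (base -` M)"
  by (rule open_vimage_base[OF open_M])

lemma
  shows jet_function_x_hat: "jet_function 2 (base -` M) (x_hat \<Gamma>)"
    and jet_function_y_hat_0: "jet_function 2 (base -` M) (y_hat \<Gamma> 0)"
    and jet_function_y1_hat: "jet_function 2 (base -` M) (\<lambda>p. snd (snd (\<Gamma> (base p))))"
proof -
  have "jet_function 2 (base -` M) (\<lambda>p. f (\<Gamma> (base p)))"
    if "bounded_linear f" for f :: "point \<Rightarrow> real"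
    using that
    by (intro jet_function_base_compose[OF open_M, of "\<lambda>m. f (\<Gamma> m)"]
        smooth_on_compose[where g = f, OF open_M open_UNIV _ smooth_\<Gamma>])
      (auto intro: smooth_on_bounded_linear)
  note this[of fst] this[of "\<lambda>m. fst (snd m)"] this[of "\<lambda>m. snd (snd m)"]
  then show "jet_function 2 (base -` M) (x_hat \<Gamma>)" "jet_function 2 (base -` M) (y_hat \<Gamma> 0)"
    "jet_function 2 (base -` M) (\<lambda>p. snd (snd (\<Gamma> (base p))))"
    by (simp_all add: x_hat_def[abs_def] bounded_linear_fst bounded_linear_fst_comp
        bounded_linear_snd_comp bounded_linear_snd)
qed

lemma
  assumes "base p \<in> M"
  shows derivative_x_hat: "frechet_derivative (x_hat \<Gamma>) (at p) v
      = fst v * dx \<Phi> (proj (base p)) + yc 1 v * dy1 \<Phi> (proj (base p))"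
    and derivative_y_hat_0: "frechet_derivative (y_hat \<Gamma> 0) (at p) v = k * yc 0 v
      + (fst v * dx \<Theta> (proj (base p)) + yc 1 v * dy1 \<Theta> (proj (base p)))"
    and derivative_y1_hat: "frechet_derivative (\<lambda>p. snd (snd (\<Gamma> (base p)))) (at p) v
      = fst v * dx \<Psi> (proj (base p)) + yc 1 v * dy1 \<Psi> (proj (base p))"
proof -
  note d = has_derivative_base_compose[OF smooth_\<Gamma> assms]
  have base: "base v = (fst v, yc 0 v, yc 1 v)" by (simp add: base_def)
  have "x_hat \<Gamma> = (\<lambda>p. fst (\<Gamma> (base p)))" by (simp add: x_hat_def fun_eq_iff)
  with frechet_derivative_eqI[OF has_derivative_fst[OF d], of v]
  show "frechet_derivative (x_hat \<Gamma>) (at p) v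
      = fst v * dx \<Phi> (proj (base p)) + yc 1 v * dy1 \<Phi> (proj (base p))"
    by (simp add: derivative_\<Gamma>[OF assms] base)
  show "frechet_derivative (y_hat \<Gamma> 0) (at p) v = k * yc 0 v
      + (fst v * dx \<Theta> (proj (base p)) + yc 1 v * dy1 \<Theta> (proj (base p)))"
    using frechet_derivative_eqI[OF has_derivative_fst[OF has_derivative_snd[OF d]], of v]
    by (simp add: derivative_\<Gamma>[OF assms] base)
  show "frechet_derivative (\<lambda>p. snd (snd (\<Gamma> (base p)))) (at p) v
      = fst v * dx \<Psi> (proj (base p)) + yc 1 v * dy1 \<Psi> (proj (base p))"
    using frechet_derivative_eqI[OF has_derivative_snd[OF has_derivative_snd[OF d]], of v]
    by (simp add: derivative_\<Gamma>[OF assms] base)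
qed

text \<open>
  The identity \<open>\<Gamma>\<^sup>* (dy - y' dx) = k (dy - y' dx)\<close>, evaluated on a tangent vector of the jet space.
\<close>

lemma contact_form:
  assumes "base p \<in> M"
  shows "frechet_derivative (y_hat \<Gamma> 0) (at p) v
    = snd (snd (\<Gamma> (base p))) * frechet_derivative (x_hat \<Gamma>) (at p) v
      + k * (yc 0 v - yc 1 p * fst v)"
proof -
  note z = proj_mem[OF assms]
  have y1: "snd (proj (base p)) = yc 1 p" by (simp add: base_def)
  have \<Psi>: "snd (snd (\<Gamma> (base p))) = \<Psi> (proj (base p))" by (simp add: \<Gamma>_eq'[OF assms])
  show ?thesis
    using contact_x'[OF z, unfolded y1] contact_y1'[OF z]
    unfolding derivative_x_hat[OF assms] derivative_y_hat_0[OF assms] \<Psi> by algebra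
qed

lemma total_deriv_x_hat:
  assumes "base p \<in> M"
  shows "total_deriv (x_hat \<Gamma>) p = dx \<Phi> (proj (base p)) + yc 2 p * dy1 \<Phi> (proj (base p))"
  using total_deriv_frechet[OF jet_function_x_hat _ order_refl, of p] assms
  by (simp add: derivative_x_hat total_direction_components) (simp add: numeral_2_eq_2)

lemma open_regular_jets: "open regular_jets"
proof -
  have "open (base -` M \<inter> total_deriv (x_hat \<Gamma>) -` (- {0}))"
    by (rule continuous_open_preimage[OF smooth_on_continuous[OF jet_function_smooth[OF
              jet_function_total_deriv[OF open_over_M jet_function_x_hat]]] open_over_M]) auto
  also have "base -` M \<inter> total_deriv (x_hat \<Gamma>) -` (- {0}) = regular_jets"
    by (auto simp: regular_jets_def)
  finally show ?thesis .
qed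

lemma regular_subset: "regular_jets \<subseteq> base -` M"
  by (auto simp: regular_jets_def)

lemma regular_base: "p \<in> regular_jets \<Longrightarrow> base p \<in> M"
  by (simp add: regular_jets_def)

lemma regular_nonzero: "p \<in> regular_jets \<Longrightarrow> total_deriv (x_hat \<Gamma>) p \<noteq> 0"
  by (simp add: regular_jets_def)

lemma y_hat_Suc_mult:
  "p \<in> regular_jets \<Longrightarrow> y_hat \<Gamma> (Suc j) p * total_deriv (x_hat \<Gamma>) p = total_deriv (y_hat \<Gamma> j) p"
  by (simp add: regular_jets_def)

lemma y_hat_1:
  assumes "p \<in> regular_jets"
  shows "y_hat \<Gamma> 1 p = snd (snd (\<Gamma> (base p)))"
proof -
  have p: "base p \<in> M" "p \<in> base -` M" using regular_base[OF assms] by auto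
  have "total_deriv (y_hat \<Gamma> 0) p
      = snd (snd (\<Gamma> (base p))) * total_deriv (x_hat \<Gamma>) p"
    by (simp add: total_deriv_frechet[OF jet_function_y_hat_0 p(2) order_refl]
        total_deriv_frechet[OF jet_function_x_hat p(2) order_refl] contact_form[OF p(1)]
        total_direction_components del: y_hat.simps)
  then show ?thesis using regular_nonzero[OF assms] by simp
qed

lemma base_prolong:
  assumes "p \<in> regular_jets" "2 \<le> N"
  shows "base (prolong N \<Gamma> p) = \<Gamma> (base p)"
  using assms y_hat_1[OF assms(1)] by (simp add: base_def[of "prolong N \<Gamma> p"] yc_prolong fst_prolong
      x_hat_def del: y_hat.simps(2) One_nat_def) 

text \<open>
  A contact transformation does not raise the order: \<open>y_hat \<Gamma> 1\<close> equals the third component of \<open>\<Gamma>\<close>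
  and therefore has no dependence on \<open>y''\<close>, although its defining quotient seems to have one. From
  there on each step raises the order by one.
\<close>

lemma jet_function_y_hat: "jet_function (max 2 (Suc j)) regular_jets (y_hat \<Gamma> j)"
proof (induction j)
  case 0
  show ?case using jet_function_mono[OF jet_function_y_hat_0 _ regular_subset] by simp
next
  case (Suc j)
  note S = open_regular_jets
  show ?case
  proof (cases j)
    case 0
    have "jet_function 2 regular_jets (y_hat \<Gamma> (Suc 0))"
      by (rule jet_function_cong[OF S _ jet_function_mono[OF jet_function_y1_hat order_refl
              regular_subset]]) (simp add: y_hat_1[unfolded One_nat_def] del: y_hat.simps(2))
    with 0 show ?thesis by (simp add: numeral_2_eq_2 del: y_hat.simps(2))
  next
    case (Suc i)
    have "jet_function (Suc (Suc j)) regular_jets (total_deriv (y_hat \<Gamma> j))"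
      using jet_function_total_deriv[OF S Suc.IH] Suc by simp
    moreover have "jet_function (Suc (Suc j)) regular_jets (total_deriv (x_hat \<Gamma>))"
      by (rule jet_function_mono[OF jet_function_total_deriv[OF open_over_M jet_function_x_hat]
            _ regular_subset]) (use Suc in simp)
    ultimately have "jet_function (Suc (Suc j)) regular_jets
        (\<lambda>p. total_deriv (y_hat \<Gamma> j) p / total_deriv (x_hat \<Gamma>) p)"
      by (rule jet_function_divide[OF S]) (rule regular_nonzero)
    then show ?thesis by simp
  qed
qed

lemma has_derivative_prolong:
  assumes "p \<in> regular_jets"
  shows "(prolong N \<Gamma> has_derivative (\<lambda>v. (frechet_derivative (x_hat \<Gamma>) (at p) v,
    \<Sum>j<N. Poly_Mapping.single j (frechet_derivative (y_hat \<Gamma> j) (at p) v)))) (at p)"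
proof -
  have x: "(x_hat \<Gamma> has_derivative frechet_derivative (x_hat \<Gamma>) (at p)) (at p)"
    using jet_function_has_derivative[OF jet_function_x_hat] regular_base[OF assms] by simp
  have "((\<lambda>p. (x_hat \<Gamma> p, \<Sum>j<N. y_hat \<Gamma> j p *\<^sub>R Poly_Mapping.single j (1::real))) has_derivative
    (\<lambda>v. (frechet_derivative (x_hat \<Gamma>) (at p) v,
      \<Sum>j<N. frechet_derivative (y_hat \<Gamma> j) (at p) v *\<^sub>R Poly_Mapping.single j 1))) (at p)"
    by (intro has_derivative_Pair has_derivative_sum has_derivative_scaleR_left x
        jet_function_has_derivative[OF jet_function_y_hat assms])
  then show ?thesis
    by (simp only: prolong_def[abs_def] jet_single_eq[symmetric])
qed

lemma has_derivative_compose_prolong: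
  assumes "p \<in> regular_jets" "jet_function m T f" "prolong N \<Gamma> p \<in> T" "m \<le> N"
  shows "((\<lambda>p. f (prolong N \<Gamma> p)) has_derivative
    (\<lambda>v. frechet_derivative (x_hat \<Gamma>) (at p) v * jet_dx f (prolong N \<Gamma> p) +
      (\<Sum>j<N. frechet_derivative (y_hat \<Gamma> j) (at p) v * jet_dy j f (prolong N \<Gamma> p)))) (at p)"
proof -
  have "((\<lambda>p. f (prolong N \<Gamma> p)) has_derivative
    (\<lambda>v. frechet_derivative f (at (prolong N \<Gamma> p)) (frechet_derivative (x_hat \<Gamma>) (at p) v,
      \<Sum>j<N. Poly_Mapping.single j (frechet_derivative (y_hat \<Gamma> j) (at p) v)))) (at p)"
    by (rule has_derivative_compose[where g = f, OF has_derivative_prolong[OF assms(1)]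
          jet_function_has_derivative[OF assms(2,3)]])
  then show ?thesis
    by (simp add: jet_function_derivative[OF assms(2,3,4)] yc_Pair_sum)
qed

text \<open>
  The prolongation maps the direction of \<open>D\<close> to \<open>(D x_hat) D\<close>, because \<open>y_hat \<Gamma> (j + 1)\<close> is defined
  as the quotient of total derivatives. The strict bound \<open>m < N\<close> is needed since the coordinate of
  index \<open>N\<close> of the truncated prolongation is \<open>0\<close> and not \<open>y_hat \<Gamma> N\<close>.
\<close>

lemma total_deriv_compose_prolong:
  assumes "p \<in> regular_jets" "jet_function m T f" "prolong N \<Gamma> p \<in> T" "m < N"
  shows "total_deriv (\<lambda>p. f (prolong N \<Gamma> p)) p
    = total_deriv (x_hat \<Gamma>) p * total_deriv f (prolong N \<Gamma> p)"
proof -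
  obtain N' where N: "N = Suc N'" "m \<le> N'" using assms(4) by (cases N) auto
  let ?q = "prolong N \<Gamma> p"
  have d: "frechet_derivative (\<lambda>p. f (prolong N \<Gamma> p)) (at p) v
      = frechet_derivative (x_hat \<Gamma>) (at p) v * jet_dx f ?q
        + (\<Sum>j<N. frechet_derivative (y_hat \<Gamma> j) (at p) v * jet_dy j f ?q)" for v
    by (rule frechet_derivative_eqI)
      (rule has_derivative_compose_prolong[OF assms(1-3)], use assms(4) in simp)
  have "total_deriv (\<lambda>p. f (prolong N \<Gamma> p)) p
      = total_deriv (x_hat \<Gamma>) p * jet_dx f ?q + (\<Sum>j<N. total_deriv (y_hat \<Gamma> j) p * jet_dy j f ?q)"
    unfolding total_deriv_def
    by (simp add: jet_dx_def[of "\<lambda>p. f (prolong N \<Gamma> p)"] jet_dy_def[of _ "\<lambda>p. f (prolong N \<Gamma> p)"] d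
        jet_dx_def[of "x_hat \<Gamma>"] jet_dy_def[of _ "x_hat \<Gamma>"] jet_dx_def[of "y_hat \<Gamma> _"]
        jet_dy_def[of _ "y_hat \<Gamma> _"] sum.distrib sum_distrib_left sum_distrib_right algebra_simps
        sum.swap[of _ "{..<N}"])
  also have "\<dots> = total_deriv (x_hat \<Gamma>) p * (jet_dx f ?q + (\<Sum>j<N. y_hat \<Gamma> (Suc j) p * jet_dy j f ?q))"
    using y_hat_Suc_mult[OF assms(1)]
    by (simp add: sum_distrib_left distrib_left mult_ac del: y_hat.simps)
      (metis (no_types, lifting) mult.assoc mult.commute)
  also have "(\<Sum>j<N. y_hat \<Gamma> (Suc j) p * jet_dy j f ?q) = (\<Sum>j<N'. yc (Suc j) ?q * jet_dy j f ?q)"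
    using jet_function_dy_zero[OF assms(2,3) N(2)] by (simp add: N(1) yc_prolong)
  also have "jet_dx f ?q + \<dots> = total_deriv f ?q"
    by (rule total_deriv_eq[OF assms(2,3) N(2), symmetric])
  finally show ?thesis .
qed

text \<open>
  The factor \<open>\<mu>\<close> of the introduction.
\<close>

lemma evolution_x_hat:
  assumes Q: "smooth_on M Q" and Q': "smooth_on M Q'"
    and rel: "\<And>m. m \<in> M \<Longrightarrow> k * Q' m = Q (\<Gamma> m)"
    and p: "base p \<in> M" and N: "2 \<le> N"
  shows "evolution N (\<lambda>p. Q' (base p)) (x_hat \<Gamma>) p
    = total_deriv (x_hat \<Gamma>) p * d3y1 Q' (base p) - d3y1 Q (\<Gamma> (base p))"
proof -
  have B: "p \<in> base -` M" using p by simp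
  have base: "base (total_direction 2 p) = (1, yc 1 p, yc 2 p)"
    by (simp add: base_def total_direction_components) (simp add: numeral_2_eq_2)
  have "total_deriv (\<lambda>p. Q' (base p)) p = frechet_derivative Q' (at (base p)) (base (total_direction 2 p))"
    by (simp only: total_deriv_frechet[OF jet_function_base_compose[OF open_M Q'] B order_refl]
        frechet_derivative_eqI[OF has_derivative_base_compose[OF Q' p]])
  then have D: "total_deriv (\<lambda>p. Q' (base p)) p
      = d3x Q' (base p) + yc 1 p * d3y Q' (base p) + yc 2 p * d3y1 Q' (base p)"
    by (simp add: frechet_derivative_d3[OF smooth_on_differentiable[OF Q' p]] base)
  have E: "evolution N (\<lambda>p. Q' (base p)) (x_hat \<Gamma>) p
      = total_deriv (\<lambda>p. Q' (base p)) p * dy1 \<Phi> (proj (base p))"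
    using N by (simp add: evolution_frechet[OF jet_function_x_hat B N] derivative_x_hat[OF p]
        evolution_direction_components)
  have y1: "snd (snd (base p)) = yc 1 p" by (simp add: base_def)
  show ?thesis
    using characteristic_x[OF Q Q' rel p, unfolded y1]
    unfolding E D total_deriv_x_hat[OF p] y1 by algebra
qed

text \<open>
  The prolongation carries the evolutionary field of \<open>Q'\<close> to that of \<open>Q\<close> plus \<open>\<mu> D\<close>. The case
  \<open>j = 0\<close> is the contact form on a vector with \<open>dx = 0\<close>, \<open>dy = Q'\<close>. The step applies both fields to
  \<open>y_hat \<Gamma> (j + 1) * D x_hat = D (y_hat \<Gamma> j)\<close> and interchanges them with \<open>D\<close>; the terms with \<open>D \<mu>\<close>
  cancel.
\<close>

lemma evolution_y_hat:
  assumes Q: "smooth_on M Q" and Q': "smooth_on M Q'"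
    and rel: "\<And>m. m \<in> M \<Longrightarrow> k * Q' m = Q (\<Gamma> m)"
  shows "p \<in> regular_jets \<Longrightarrow> j + 2 < N \<Longrightarrow>
    evolution N (\<lambda>p. Q' (base p)) (y_hat \<Gamma> j) p
      = (total_deriv ^^ j) (\<lambda>p. Q (base p)) (prolong N \<Gamma> p)
        + evolution N (\<lambda>p. Q' (base p)) (x_hat \<Gamma>) p * y_hat \<Gamma> (Suc j) p"
proof (induction j arbitrary: p)
  case 0
  then have p: "base p \<in> M" "p \<in> base -` M" and N: "2 \<le> N"
    using regular_base by auto
  have "evolution N (\<lambda>p. Q' (base p)) (y_hat \<Gamma> 0) p
      = snd (snd (\<Gamma> (base p))) * evolution N (\<lambda>p. Q' (base p)) (x_hat \<Gamma>) p + k * Q' (base p)"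
    using N
    by (simp add: evolution_frechet[OF jet_function_y_hat_0 p(2) N]
        evolution_frechet[OF jet_function_x_hat p(2) N] contact_form[OF p(1)]
        evolution_direction_components del: y_hat.simps)
  also have "k * Q' (base p) = Q (base (prolong N \<Gamma> p))"
    using rel[OF p(1)] base_prolong[OF 0(1) N] by simp
  also have "snd (snd (\<Gamma> (base p))) = y_hat \<Gamma> (Suc 0) p"
    using y_hat_1[OF 0(1)] by simp
  finally show ?case by (simp del: y_hat.simps)
next
  case (Suc j)
  let ?q = "\<lambda>p. Q (base p)" and ?q' = "\<lambda>p. Q' (base p)"
  let ?E = "evolution N ?q'" and ?D = "total_deriv" and ?pr = "prolong N \<Gamma>"
  note S = open_regular_jets and p = Suc.prems(1)
  have N: "j + 2 < N" "2 \<le> N" "2 < N" "max 2 (Suc j) < N" using Suc.prems(2) by auto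
  have q: "jet_function (2 + j) (base -` M) ((?D ^^ j) ?q)"
    by (rule jet_function_funpow_total_deriv[OF open_over_M jet_function_base_compose[OF open_M Q]])
  have q': "jet_function 2 regular_jets ?q'"
    by (rule jet_function_mono[OF jet_function_base_compose[OF open_M Q'] order_refl regular_subset])
  have x: "jet_function 2 regular_jets (x_hat \<Gamma>)"
    by (rule jet_function_mono[OF jet_function_x_hat order_refl regular_subset])
  have pr: "?pr p \<in> base -` M"
    using base_prolong[OF p N(2)] \<Gamma>_mem[OF regular_base[OF p]] by simp
  note y = jet_function_y_hat
  note d = jet_function_differentiable[OF _ p]
  have dq: "(\<lambda>p. (?D ^^ j) ?q (?pr p)) differentiable (at p)"
    using has_derivative_compose_prolong[OF p q pr] N(1) by (auto simp: differentiable_def)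
  have d\<mu>: "?E (x_hat \<Gamma>) differentiable (at p)"
    by (rule d[OF jet_function_evolution[OF S x q']])
  have dy: "y_hat \<Gamma> (Suc j) differentiable (at p)" by (rule d[OF y])
  have dDx: "?D (x_hat \<Gamma>) differentiable (at p)" by (rule d[OF jet_function_total_deriv[OF S x]])
  have "?E (?D (y_hat \<Gamma> j)) p = ?E (\<lambda>p. y_hat \<Gamma> (Suc j) p * ?D (x_hat \<Gamma>) p) p"
    by (rule evolution_cong[OF S p d[OF jet_function_total_deriv[OF S y]]])
      (rule y_hat_Suc_mult[symmetric])
  also have "\<dots> = y_hat \<Gamma> (Suc j) p * ?E (?D (x_hat \<Gamma>)) p + ?E (y_hat \<Gamma> (Suc j)) p * ?D (x_hat \<Gamma>) p"
    by (rule evolution_mult[OF dy dDx])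
  also have "?E (?D (x_hat \<Gamma>)) p = ?D (?E (x_hat \<Gamma>)) p"
    by (rule evolution_total_deriv[OF S x q' N(3) p])
  finally have 1: "?E (?D (y_hat \<Gamma> j)) p
      = y_hat \<Gamma> (Suc j) p * ?D (?E (x_hat \<Gamma>)) p + ?E (y_hat \<Gamma> (Suc j)) p * ?D (x_hat \<Gamma>) p" .
  have "?E (?D (y_hat \<Gamma> j)) p = ?D (?E (y_hat \<Gamma> j)) p"
    by (rule evolution_total_deriv[OF S y q' N(4) p])
  also have "\<dots> = ?D (\<lambda>p. (?D ^^ j) ?q (?pr p) + ?E (x_hat \<Gamma>) p * y_hat \<Gamma> (Suc j) p) p"
    by (rule total_deriv_cong[OF S p d[OF jet_function_evolution[OF S y q']]])
      (rule Suc.IH[OF _ N(1)])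
  also have "\<dots> = ?D (\<lambda>p. (?D ^^ j) ?q (?pr p)) p
      + ?D (\<lambda>p. ?E (x_hat \<Gamma>) p * y_hat \<Gamma> (Suc j) p) p"
    by (intro total_deriv_add dq differentiable_mult d\<mu> dy)
  also have "?D (\<lambda>p. (?D ^^ j) ?q (?pr p)) p = ?D (x_hat \<Gamma>) p * ?D ((?D ^^ j) ?q) (?pr p)"
    by (rule total_deriv_compose_prolong[OF p q pr]) (use N in simp)
  also have "?D (\<lambda>p. ?E (x_hat \<Gamma>) p * y_hat \<Gamma> (Suc j) p) p
      = ?E (x_hat \<Gamma>) p * ?D (y_hat \<Gamma> (Suc j)) p + ?D (?E (x_hat \<Gamma>)) p * y_hat \<Gamma> (Suc j) p"
    by (rule total_deriv_mult[OF d\<mu> dy])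
  also have "?D (y_hat \<Gamma> (Suc j)) p = y_hat \<Gamma> (Suc (Suc j)) p * ?D (x_hat \<Gamma>) p"
    by (rule y_hat_Suc_mult[OF p, symmetric])
  finally have 2: "?E (?D (y_hat \<Gamma> j)) p = ?D (x_hat \<Gamma>) p * ?D ((?D ^^ j) ?q) (?pr p)
      + (?E (x_hat \<Gamma>) p * (y_hat \<Gamma> (Suc (Suc j)) p * ?D (x_hat \<Gamma>) p)
        + ?D (?E (x_hat \<Gamma>)) p * y_hat \<Gamma> (Suc j) p)" .
  have "?D (x_hat \<Gamma>) p * ?E (y_hat \<Gamma> (Suc j)) p = ?D (x_hat \<Gamma>) p *
      (?D ((?D ^^ j) ?q) (?pr p) + ?E (x_hat \<Gamma>) p * y_hat \<Gamma> (Suc (Suc j)) p)"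
    using 1 2 by algebra
  then have "?E (y_hat \<Gamma> (Suc j)) p
      = ?D ((?D ^^ j) ?q) (?pr p) + ?E (x_hat \<Gamma>) p * y_hat \<Gamma> (Suc (Suc j)) p"
    by (simp only: mult_left_cancel[OF regular_nonzero[OF p]])
  then show ?case by (simp only: funpow.simps comp_apply)
qed

lemma jet_dy_y_hat_Suc:
  assumes p: "p \<in> regular_jets" and j: "1 \<le> j"
  shows "y_hat \<Gamma> (Suc j) p * jet_dy (Suc j) (total_deriv (x_hat \<Gamma>)) p
      + jet_dy (Suc j) (y_hat \<Gamma> (Suc j)) p * total_deriv (x_hat \<Gamma>) p = jet_dy j (y_hat \<Gamma> j) p"
proof -
  note S = open_regular_jets
  have x: "jet_function 2 regular_jets (x_hat \<Gamma>)"
    by (rule jet_function_mono[OF jet_function_x_hat order_refl regular_subset])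
  note d = jet_function_differentiable[OF _ p]
  have dDx: "total_deriv (x_hat \<Gamma>) differentiable (at p)"
    by (rule d[OF jet_function_total_deriv[OF S x]])
  have "y_hat \<Gamma> (Suc j) p * jet_dy (Suc j) (total_deriv (x_hat \<Gamma>)) p
      + jet_dy (Suc j) (y_hat \<Gamma> (Suc j)) p * total_deriv (x_hat \<Gamma>) p
      = jet_dy (Suc j) (\<lambda>p. y_hat \<Gamma> (Suc j) p * total_deriv (x_hat \<Gamma>) p) p"
    by (rule jet_dy_mult[OF d[OF jet_function_y_hat] dDx, symmetric])
  also have "\<dots> = jet_dy (Suc j) (total_deriv (y_hat \<Gamma> j)) p"
    unfolding jet_dy_def
    by (rule frechet_derivative_transform_within_open[OF _ S p, THEN fun_cong])
      (auto intro: differentiable_mult d[OF jet_function_y_hat] dDx simp: y_hat_Suc_mult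
        simp del: y_hat.simps)
  also have "\<dots> = jet_dy j (y_hat \<Gamma> j) p"
    by (rule jet_dy_Suc_total_deriv_top[OF S jet_function_y_hat _ p]) (use j in simp)
  finally show ?thesis .
qed

text \<open>
  The leading coefficient is \<open>k / (D x_hat)\<^sup>2\<close> for \<open>y''\<close>, and each further derivative divides it by
  \<open>D x_hat\<close>.
\<close>

lemma jet_dy_y_hat_nonzero:
  assumes p: "p \<in> regular_jets"
  shows "jet_dy (Suc (Suc j)) (y_hat \<Gamma> (Suc (Suc j))) p \<noteq> 0"
proof (induction j)
  case 0
  note S = open_regular_jets
  let ?P = "\<lambda>p. snd (snd (\<Gamma> (base p)))"
  let ?z = "proj (base p)"
  have b: "base p \<in> M" "p \<in> base -` M" using regular_base[OF p] by auto
  have yc1: "yc 1 (jet_unit 1) = 1" by (simp add: yc_Pair_single)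
  have x1: "jet_dy (Suc 1) (total_deriv (x_hat \<Gamma>)) p = dy1 \<Phi> ?z"
    using jet_dy_Suc_total_deriv_top[OF open_over_M jet_function_x_hat _ b(2), of 1] yc1
    by (simp add: jet_dy_def derivative_x_hat[OF b(1)])
  have "jet_dy 1 (y_hat \<Gamma> 1) p = jet_dy 1 ?P p"
    unfolding jet_dy_def
    by (rule frechet_derivative_transform_within_open[OF _ S p, THEN fun_cong])
      (auto intro: jet_function_differentiable[OF jet_function_y_hat p] simp: y_hat_1[unfolded One_nat_def]
        simp del: y_hat.simps)
  also have "\<dots> = dy1 \<Psi> ?z"
    using yc1 by (simp add: jet_dy_def derivative_y1_hat[OF b(1)])
  finally have y1: "jet_dy 1 (y_hat \<Gamma> 1) p = dy1 \<Psi> ?z" .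
  have "total_deriv (y_hat \<Gamma> 1) p = total_deriv ?P p"
    by (rule total_deriv_cong[OF S p jet_function_differentiable[OF jet_function_y_hat p]])
      (rule y_hat_1)
  also have "\<dots> = dx \<Psi> ?z + yc 2 p * dy1 \<Psi> ?z"
    using total_deriv_frechet[OF jet_function_y1_hat b(2) order_refl]
    by (simp add: derivative_y1_hat[OF b(1)] total_direction_components) (simp add: numeral_2_eq_2)
  finally have "y_hat \<Gamma> (Suc 1) p * total_deriv (x_hat \<Gamma>) p = dx \<Psi> ?z + yc 2 p * dy1 \<Psi> ?z"
    by (simp only: y_hat_Suc_mult[OF p])
  \<comment> \<open>Multiplying by \<open>D x_hat\<close> a second time removes the quotient \<open>y_hat \<Gamma> 2\<close> and leaves the Jacobian.\<close>
  moreover have "w * D * D = K"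
    if "u * D = c + y * d" "u * b + w * D = d" "D = a + y * b" "a * d - b * c = K"
    for a b c d u w y D K :: real
    using that by algebra
  ultimately have "jet_dy (Suc 1) (y_hat \<Gamma> (Suc 1)) p * total_deriv (x_hat \<Gamma>) p
      * total_deriv (x_hat \<Gamma>) p = k"
    using jet_dy_y_hat_Suc[OF p order_refl, unfolded x1 y1] total_deriv_x_hat[OF b(1)]
      jacobian[OF proj_mem[OF b(1)]] by blast
  with k_nonzero show ?case by auto
next
  case (Suc j)
  have x: "jet_dy (Suc (Suc (Suc j))) (total_deriv (x_hat \<Gamma>)) p = 0"
    by (rule jet_function_dy_zero[OF jet_function_total_deriv[OF open_over_M jet_function_x_hat]])
      (use regular_base[OF p] in auto)
  from jet_dy_y_hat_Suc[OF p, of "Suc (Suc j)"] Suc show ?case by (auto simp: x simp del: y_hat.simps)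
qed

end

section \<open>The linearized symmetry condition\<close>

text \<open>
  Along a coordinate direction of index at least \<open>n\<close> the function \<open>\<omega>\<close> is constant.
\<close>

lemma jet_function_rhs:
  assumes "ode_rhs n U \<omega>"
  shows "jet_function n U \<omega>"
  unfolding jet_function_def
proof (intro conjI ballI allI impI)
  show "smooth_on U \<omega>" using assms by (simp add: ode_rhs_def)
  fix p j assume p: "p \<in> U" and j: "n \<le> j"
  have "((\<lambda>t. p + t *\<^sub>R jet_unit j) has_derivative (\<lambda>t. t *\<^sub>R jet_unit j)) (at 0)"
    by (auto intro!: derivative_eq_intros)
  then have "((\<lambda>t. \<omega> (p + t *\<^sub>R jet_unit j)) has_derivative
      (\<lambda>t. frechet_derivative \<omega> (at p) (t *\<^sub>R jet_unit j))) (at 0)"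
    by (rule has_derivative_compose[where g = \<omega>])
      (use smooth_on_has_derivative[OF \<open>smooth_on U \<omega>\<close> p] in \<open>simp add: zero_prod_def[symmetric]\<close>)
  moreover have "\<omega> (p + t *\<^sub>R jet_unit j) = \<omega> p" for t
  proof -
    have "jet_agree n p (p + t *\<^sub>R jet_unit j)"
      using j by (auto simp: jet_agree_def yc_add yc_scaleR yc_Pair_single simp del: scaleR_Pair)
    with assms p show ?thesis unfolding ode_rhs_def by blast
  qed
  ultimately have "((\<lambda>t::real. \<omega> p) has_derivative
      (\<lambda>t. frechet_derivative \<omega> (at p) (t *\<^sub>R jet_unit j))) (at 0)" by simp
  from fun_cong[OF has_derivative_unique[OF this has_derivative_const], of 1]
  show "jet_dy j \<omega> p = 0" by (simp add: jet_dy_def)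
qed

definition defect :: "nat \<Rightarrow> (jet \<Rightarrow> real) \<Rightarrow> jet \<Rightarrow> real"
  where "defect n \<omega> p = yc n p - \<omega> p"

lemma ode_set_defect: "ode_set n U \<omega> = {p \<in> U. defect n \<omega> p = 0}"
  by (auto simp: ode_set_def defect_def)

lemma has_derivative_defect:
  assumes "ode_rhs n U \<omega>" "p \<in> U"
  shows "(defect n \<omega> has_derivative (\<lambda>v. yc n v - frechet_derivative \<omega> (at p) v)) (at p)"
  unfolding defect_def[abs_def]
  by (intro has_derivative_diff bounded_linear_imp_has_derivative bounded_linear_yc
      jet_function_has_derivative[OF jet_function_rhs[OF assms(1)] assms(2)])

lemma jet_dy_defect:
  assumes "ode_rhs n U \<omega>" "p \<in> U"
  shows "jet_dy j (defect n \<omega>) p = (if j = n then 1 else 0) - jet_dy j \<omega> p"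
proof -
  have "yc n (jet_unit j) = (if j = n then 1 else 0)" by (rule yc_Pair_single)
  then show ?thesis
    by (simp add: jet_dy_def frechet_derivative_eqI[OF has_derivative_defect[OF assms]])
qed

lemma jet_dx_defect:
  assumes "ode_rhs n U \<omega>" "p \<in> U"
  shows "jet_dx (defect n \<omega>) p = - jet_dx \<omega> p"
  by (simp add: jet_dx_def frechet_derivative_eqI[OF has_derivative_defect[OF assms]])
    (simp add: yc_def)

lemma jet_function_defect:
  assumes "ode_rhs n U \<omega>"
  shows "jet_function (Suc n) U (defect n \<omega>)"
proof -
  have U: "open U" using assms by (simp add: ode_rhs_def)
  have "smooth_on U (defect n \<omega>)"
    unfolding defect_def[abs_def]
    by (intro smooth_on_diff smooth_on_bounded_linear bounded_linear_yc U
        jet_function_smooth[OF jet_function_rhs[OF assms]])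
  then show ?thesis
    by (simp add: jet_function_def jet_dy_defect[OF assms]
        jet_function_dy_zero[OF jet_function_rhs[OF assms]])
qed

text \<open>
  The terms \<open>- y\<^sup>(\<^sup>j\<^sup>+\<^sup>1\<^sup>) Q\<^sub>y\<^sub>'\<close> of the prolongation coefficients and the term with \<open>\<omega>\<^sub>x\<close> combine to
  \<open>Q\<^sub>y\<^sub>'\<close> times the total derivative of \<open>F = y\<^sup>(\<^sup>n\<^sup>) - \<omega>\<close>.
\<close>

lemma linearized_condition_iff_evolution:
  assumes ode: "ode_rhs n U \<omega>" and p: "p \<in> U" and N: "n < N"
  shows "prol_coeff Q n p
      = - d3y1 Q (base p) * jet_dx \<omega> p + (\<Sum>j<n. prol_coeff Q j p * jet_dy j \<omega> p)
    \<longleftrightarrow> evolution N (\<lambda>q. Q (base q)) (defect n \<omega>) p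
      = d3y1 Q (base p) * total_deriv (defect n \<omega>) p"
proof -
  let ?q = "\<lambda>j. (total_deriv ^^ j) (\<lambda>q. Q (base q)) p"
  have F0: "jet_dy j (defect n \<omega>) p = 0" if "Suc n \<le> j" for j
    by (rule jet_function_dy_zero[OF jet_function_defect[OF ode] p that])
  have \<omega>n: "jet_dy n \<omega> p = 0"
    by (rule jet_function_dy_zero[OF jet_function_rhs[OF ode] p order_refl])
  have "evolution N (\<lambda>q. Q (base q)) (defect n \<omega>) p
      = (\<Sum>j<Suc n. ?q j * jet_dy j (defect n \<omega>) p)"
    unfolding evolution_def using N F0 by (intro sum.mono_neutral_right) auto
  also have "\<dots> = ?q n - (\<Sum>j<n. ?q j * jet_dy j \<omega> p)"
    by (simp add: jet_dy_defect[OF ode p] \<omega>n sum_negf)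
  finally have E: "evolution N (\<lambda>q. Q (base q)) (defect n \<omega>) p
      = ?q n - (\<Sum>j<n. ?q j * jet_dy j \<omega> p)" .
  have D: "total_deriv (defect n \<omega>) p
      = yc (Suc n) p - jet_dx \<omega> p - (\<Sum>j<n. yc (Suc j) p * jet_dy j \<omega> p)"
    by (simp add: total_deriv_eq[OF jet_function_defect[OF ode] p order_refl]
        jet_dy_defect[OF ode p] jet_dx_defect[OF ode p] \<omega>n sum_negf)
  have "(\<Sum>j<n. prol_coeff Q j p * jet_dy j \<omega> p) = (\<Sum>j<n. ?q j * jet_dy j \<omega> p)
      - d3y1 Q (base p) * (\<Sum>j<n. yc (Suc j) p * jet_dy j \<omega> p)"
    by (simp add: prol_coeff_def algebra_simps sum_subtractf sum_distrib_left)
  then show ?thesis unfolding E D by (auto simp: prol_coeff_def algebra_simps)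
qed

context contact_transformation
begin

text \<open>
  The central computation. Write \<open>F\<close> for the defect, \<open>q\<close> for the prolongation of \<open>p\<close> and
  \<open>G = F \<circ> pr \<Gamma>\<close>, and let \<open>E\<close>, \<open>E'\<close> be the evolutionary fields of \<open>Q\<close>, \<open>Q'\<close>. With \<open>dG = \<lambda> dF\<close>,
  \<open>\<lambda> E'F = E'G = (E F)(q) + \<mu> (D F)(q) = (Q\<^sub>y\<^sub>'(\<Gamma>) + \<mu>) (D F)(q)\<close>,
  and \<open>Q\<^sub>y\<^sub>'(\<Gamma>) + \<mu> = (D x_hat) Q'\<^sub>y\<^sub>'\<close>, \<open>(D x_hat) (D F)(q) = D G = \<lambda> D F\<close>. Cancel \<open>\<lambda>\<close>.
\<close>

lemma linearized_condition_at_regular_jet: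
  assumes n: "2 \<le> n" and ode: "ode_rhs n U \<omega>" and M: "M = base ` U"
    and sym: "\<And>p. p \<in> ode_set n U \<omega> \<Longrightarrow> total_deriv (x_hat \<Gamma>) p \<noteq> 0 \<Longrightarrow>
      prolong n \<Gamma> p \<in> U \<and> y_hat \<Gamma> n p = \<omega> (prolong n \<Gamma> p)"
    and Q: "smooth_on M Q" and Q': "smooth_on M Q'"
    and rel: "\<And>m. m \<in> M \<Longrightarrow> k * Q' m = Q (\<Gamma> m)"
    and lin: "linearized_symmetry_condition n U \<omega> Q"
    and p: "p \<in> ode_set n U \<omega>" "total_deriv (x_hat \<Gamma>) p \<noteq> 0"
  shows "evolution (n + 3) (\<lambda>q. Q' (base q)) (defect n \<omega>) p
    = d3y1 Q' (base p) * total_deriv (defect n \<omega>) p"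
proof -
  \<comment> \<open>\<open>evolution_y_hat\<close> is needed up to \<open>j = n\<close>, and it requires \<open>j + 2 < N\<close>.\<close>
  define N where "N = n + 3"
  let ?F = "defect n \<omega>" and ?pr = "prolong N \<Gamma>"
  let ?E = "evolution N (\<lambda>q. Q' (base q))"
  have U: "open U" using ode by (simp add: ode_rhs_def)
  have N: "n < N" "Suc n < N" "Suc n \<le> N" "2 \<le> N" by (auto simp: N_def)
  have F: "jet_function (Suc n) U ?F" by (rule jet_function_defect[OF ode])
  have pU: "p \<in> U" using p(1) by (simp add: ode_set_def)
  then have "base p \<in> M" unfolding M by (rule imageI)
  then have reg: "p \<in> regular_jets" and B: "p \<in> base -` M"
    using p(2) by (simp_all add: regular_jets_def)
  have image: "?pr r \<in> U \<and> ?F (?pr r) = 0" if "r \<in> ode_set n U \<omega>" "r \<in> regular_jets" for r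
  proof -
    have s: "prolong n \<Gamma> r \<in> U" "y_hat \<Gamma> n r = \<omega> (prolong n \<Gamma> r)"
      using sym[OF that(1) regular_nonzero[OF that(2)]] by auto
    have "jet_agree n (prolong n \<Gamma> r) (?pr r)"
      using N by (simp add: jet_agree_def fst_prolong yc_prolong)
    with s(1) ode have "?pr r \<in> U" "\<omega> (?pr r) = \<omega> (prolong n \<Gamma> r)"
      unfolding ode_rhs_def by blast+
    with s(2) N show ?thesis by (simp add: defect_def yc_prolong)
  qed
  have prU: "?pr p \<in> U" and prF: "?pr p \<in> ode_set n U \<omega>"
    using image[OF p(1) reg] by (auto simp: ode_set_defect)
  define G where "G = (\<lambda>r. ?F (?pr r))"
  define G' where "G' = (\<lambda>v. frechet_derivative (x_hat \<Gamma>) (at p) v * jet_dx ?F (?pr p) +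
      (\<Sum>j<N. frechet_derivative (y_hat \<Gamma> j) (at p) v * jet_dy j ?F (?pr p)))"
  have dG: "(G has_derivative G') (at p)"
    unfolding G_def G'_def by (rule has_derivative_compose_prolong[OF reg F prU N(3)])
  then have linG: "linear G'" by (rule has_derivative_linear)
  define F' where "F' = frechet_derivative ?F (at p)"
  have dF: "(?F has_derivative F') (at p)"
    unfolding F'_def by (rule jet_function_has_derivative[OF F pU])

  \<comment> \<open>The map \<open>\<pi>\<close> moves a jet along \<open>y\<^sup>(\<^sup>n\<^sup>)\<close> into the equation, where \<open>G\<close> vanishes, and it fixes \<open>p\<close>.
    Thus \<open>dG\<close> vanishes on the image of \<open>d\<pi>\<close>, the kernel of \<open>dF\<close>.\<close>
  have proportional: "G' v = F' v * G' (jet_unit n)" for v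
  proof -
    let ?\<pi> = "\<lambda>r. r - ?F r *\<^sub>R jet_unit n"
    have Fp: "?F p = 0" using p(1) by (simp add: ode_set_defect)
    have d\<pi>: "(?\<pi> has_derivative (\<lambda>v. v - F' v *\<^sub>R jet_unit n)) (at p)"
      by (intro has_derivative_diff has_derivative_scaleR_left has_derivative_ident dF)
    have on_E: "?\<pi> r \<in> ode_set n U \<omega>" if "r \<in> U" for r
    proof -
      have "jet_agree n r (?\<pi> r)"
        by (auto simp: jet_agree_def yc_diff yc_scaleR yc_Pair_single simp del: scaleR_Pair)
      with that ode have "?\<pi> r \<in> U" "\<omega> (?\<pi> r) = \<omega> r" unfolding ode_rhs_def by blast+
      then show ?thesis
        by (simp add: ode_set_def yc_diff yc_scaleR yc_Pair_single defect_def del: scaleR_Pair)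
    qed
    have "continuous_on U ?\<pi>"
      by (intro continuous_intros smooth_on_continuous[OF jet_function_smooth[OF F]])
    then have nbhd: "open (U \<inter> ?\<pi> -` regular_jets)"
      by (rule continuous_open_preimage[OF _ U open_regular_jets])
    have mem: "p \<in> U \<inter> ?\<pi> -` regular_jets" using pU reg Fp by (simp add: zero_prod_def[symmetric])
    have zero: "0 = G (?\<pi> r)" if "r \<in> U \<inter> ?\<pi> -` regular_jets" for r
      using image[OF on_E, of r] that by (simp add: G_def)
    have "((\<lambda>r. G (?\<pi> r)) has_derivative (\<lambda>v. 0)) (at p)"
      by (rule has_derivative_transform_within_open[OF has_derivative_const nbhd mem zero])
    moreover have "((\<lambda>r. G (?\<pi> r)) has_derivative (\<lambda>v. G' (v - F' v *\<^sub>R jet_unit n))) (at p)"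
      by (rule has_derivative_compose[where g = G, OF d\<pi>])
        (use dG Fp in \<open>simp add: zero_prod_def[symmetric]\<close>)
    ultimately have "(\<lambda>v. 0) = (\<lambda>v. G' (v - F' v *\<^sub>R jet_unit n))"
      by (rule has_derivative_unique)
    from fun_cong[OF this, of v] have "G' (v - F' v *\<^sub>R jet_unit n) = 0" by simp
    then show ?thesis by (simp add: linear_diff[OF linG] linear_cmul[OF linG] del: scaleR_Pair)
  qed

  \<comment> \<open>The lower \<open>y_hat \<Gamma> j\<close> and \<open>x_hat \<Gamma>\<close> do not depend on \<open>y\<^sup>(\<^sup>n\<^sup>)\<close>; this uses \<open>n \<ge> 2\<close>.\<close>
  have "G' (jet_unit n) = jet_dy n (y_hat \<Gamma> n) p"
  proof -
    have "frechet_derivative (x_hat \<Gamma>) (at p) (jet_unit n) = 0"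
      using jet_function_dy_zero[OF jet_function_x_hat B n] by (simp add: jet_dy_def)
    moreover have "frechet_derivative (y_hat \<Gamma> j) (at p) (jet_unit n) * jet_dy j ?F (?pr p)
        = (if j = n then jet_dy n (y_hat \<Gamma> n) p else 0)" for j
    proof (cases j n rule: linorder_cases)
      case less
      then have "jet_dy n (y_hat \<Gamma> j) p = 0"
        using n by (intro jet_function_dy_zero[OF jet_function_y_hat reg]) simp
      with less show ?thesis by (simp add: jet_dy_def)
    next
      case equal
      then show ?thesis
        using jet_function_dy_zero[OF jet_function_rhs[OF ode] prU order_refl]
        by (simp add: jet_dy_defect[OF ode prU]) (simp add: jet_dy_def)
    next
      case greater
      then show ?thesis using jet_function_dy_zero[OF F prU, of j] by simp
    qed
    ultimately show ?thesis using N by (simp add: G'_def)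
  qed
  moreover obtain i where "n = Suc (Suc i)" using n by (metis Suc_le_D numeral_2_eq_2 Suc_le_mono)
  ultimately have top_nonzero: "G' (jet_unit n) \<noteq> 0" using jet_dy_y_hat_nonzero[OF reg, of i] by simp

  let ?\<mu> = "?E (x_hat \<Gamma>) p"
  have E_G: "G' (evolution_direction N (\<lambda>q. Q' (base q)) p)
      = evolution N (\<lambda>q. Q (base q)) ?F (?pr p) + ?\<mu> * total_deriv ?F (?pr p)"
  proof -
    have summand: "frechet_derivative (y_hat \<Gamma> j) (at p) (evolution_direction N (\<lambda>q. Q' (base q)) p)
          * jet_dy j ?F (?pr p)
        = ((total_deriv ^^ j) (\<lambda>q. Q (base q)) (?pr p) + ?\<mu> * yc (Suc j) (?pr p)) * jet_dy j ?F (?pr p)"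
      if "j < N" for j
    proof (cases "j \<le> n")
      case True
      then have j: "max 2 (Suc j) \<le> N" "j + 2 < N" "Suc j < N" by (auto simp: N_def)
      show ?thesis
        by (simp only: evolution_frechet[OF jet_function_y_hat reg j(1), symmetric]
            evolution_y_hat[OF Q Q' rel reg j(2)] yc_prolong j(3) if_True)
    next
      case False
      then show ?thesis using jet_function_dy_zero[OF F prU, of j] by simp
    qed
    have "G' (evolution_direction N (\<lambda>q. Q' (base q)) p) = ?\<mu> * jet_dx ?F (?pr p)
      + (\<Sum>j<N. ((total_deriv ^^ j) (\<lambda>q. Q (base q)) (?pr p) + ?\<mu> * yc (Suc j) (?pr p))
          * jet_dy j ?F (?pr p))"
      unfolding G'_def evolution_frechet[OF jet_function_x_hat B N(4), symmetric]
      by (intro arg_cong2[where f = "(+)"] sum.cong refl) (rule summand, simp)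
    also have "\<dots> = evolution N (\<lambda>q. Q (base q)) ?F (?pr p) + ?\<mu> * total_deriv ?F (?pr p)"
      by (simp add: evolution_def total_deriv_eq[OF F prU N(3)] algebra_simps sum.distrib
          sum_distrib_left)
    finally show ?thesis .
  qed

  have "total_deriv G p = total_deriv (x_hat \<Gamma>) p * total_deriv ?F (?pr p)"
    unfolding G_def by (rule total_deriv_compose_prolong[OF reg F prU N(2)])
  moreover have "total_deriv G p = total_deriv ?F p * G' (jet_unit n)"
  proof -
    have "frechet_derivative G (at p) v = F' v * G' (jet_unit n)" for v
      by (rule trans[OF frechet_derivative_eqI[OF dG] proportional])
    then show ?thesis
      by (simp add: total_deriv_def jet_dx_def jet_dy_def F'_def sum_distrib_right distrib_right
          mult.assoc)
  qed
  moreover have "?E ?F p = F' (evolution_direction N (\<lambda>q. Q' (base q)) p)"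
    unfolding F'_def by (rule evolution_frechet[OF F pU N(3)])
  moreover have "evolution N (\<lambda>q. Q (base q)) ?F (?pr p)
      = d3y1 Q (base (?pr p)) * total_deriv ?F (?pr p)"
    using lin prF linearized_condition_iff_evolution[OF ode prU N(1), of Q]
    by (simp add: linearized_symmetry_condition_def)
  moreover have "?\<mu> = total_deriv (x_hat \<Gamma>) p * d3y1 Q' (base p) - d3y1 Q (base (?pr p))"
    using evolution_x_hat[OF Q Q' rel _ N(4)] regular_base[OF reg] base_prolong[OF reg N(4)] by simp
  ultimately have "G' (jet_unit n) * ?E ?F p = G' (jet_unit n) * (d3y1 Q' (base p) * total_deriv ?F p)"
    using E_G proportional[of "evolution_direction N (\<lambda>q. Q' (base q)) p"] by algebra
  then show ?thesis by (simp only: mult_left_cancel[OF top_nonzero] N_def)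
qed

text \<open>
  Both sides of the condition are continuous in the jet, so its validity on the dense set of regular
  jets of the equation extends to the whole equation.
\<close>

lemma linearized_symmetry_condition_pullback:
  assumes n: "2 \<le> n" and ode: "ode_rhs n U \<omega>" and M: "M = base ` U"
    and symmetry: "uniform_contact_symmetry n U \<omega> \<Gamma>"
    and Q: "smooth_on M Q" and Q': "smooth_on M Q'"
    and rel: "\<And>m. m \<in> M \<Longrightarrow> k * Q' m = Q (\<Gamma> m)"
    and lin: "linearized_symmetry_condition n U \<omega> Q"
  shows "linearized_symmetry_condition n U \<omega> Q'"
proof -
  let ?H = "\<lambda>p. evolution (n + 3) (\<lambda>q. Q' (base q)) (defect n \<omega>) p
    - d3y1 Q' (base p) * total_deriv (defect n \<omega>) p"
  define R where "R = {p \<in> ode_set n U \<omega>. total_deriv (x_hat \<Gamma>) p \<noteq> 0}"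
  have sym: "prolong n \<Gamma> p \<in> U \<and> y_hat \<Gamma> n p = \<omega> (prolong n \<Gamma> p)"
    if "p \<in> ode_set n U \<omega>" "total_deriv (x_hat \<Gamma>) p \<noteq> 0" for p
    using symmetry that unfolding uniform_contact_symmetry_def Let_def by blast
  have dense: "ode_set n U \<omega> \<subseteq> closure R"
    using symmetry by (simp add: uniform_contact_symmetry_def Let_def R_def)
  have H_R: "?H p = 0" if "p \<in> R" for p
    using linearized_condition_at_regular_jet[OF n ode M sym Q Q' rel lin, of p] that
    by (simp add: R_def)
  have U: "open U" using ode by (simp add: ode_rhs_def)
  have sub: "U \<subseteq> base -` M" using M by auto
  have q': "jet_function 2 U (\<lambda>p. Q' (base p))"
    by (rule jet_function_mono[OF jet_function_base_compose[OF open_M Q'] order_refl sub])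
  have d': "jet_function 2 U (\<lambda>p. d3y1 Q' (base p))"
    unfolding d3y1_def
    by (rule jet_function_mono[OF jet_function_base_compose[OF open_M
          smooth_on_frechet_derivative[OF Q']] order_refl sub])
  note F = jet_function_defect[OF ode]
  have cont: "continuous_on U ?H"
    by (intro continuous_on_diff continuous_on_mult smooth_on_continuous
        jet_function_smooth[OF jet_function_evolution[OF U F q']] jet_function_smooth[OF d']
        jet_function_smooth[OF jet_function_total_deriv[OF U F]])
  have "?H p = 0" if p: "p \<in> ode_set n U \<omega>" for p
  proof (rule ccontr)
    assume "?H p \<noteq> 0"
    have "open (U \<inter> ?H -` (- {0}))"
      by (rule continuous_open_preimage[OF cont U]) auto
    moreover have "p \<in> U \<inter> ?H -` (- {0})" using p \<open>?H p \<noteq> 0\<close> by (simp add: ode_set_def)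
    moreover have "p \<in> closure R" using dense p by blast
    ultimately obtain r where "r \<in> R" "r \<in> U \<inter> ?H -` (- {0})"
      by (meson closure_iff_nhds_not_empty disjoint_iff open_Int_closure_eq_empty)
    then show False using H_R by simp
  qed
  then show ?thesis
    unfolding linearized_symmetry_condition_def
    using linearized_condition_iff_evolution[OF ode, of _ "n + 3" Q'] by (auto simp: ode_set_def)
qed

lemma pullback_generator:
  assumes n: "2 \<le> n" and ode: "ode_rhs n U \<omega>" and M: "M = base ` U"
    and symmetry: "uniform_contact_symmetry n U \<omega> \<Gamma>"
    and X: "X \<in> uniform_generators n U \<omega>"
  shows "pullback M \<Gamma> X \<in> uniform_generators n U \<omega>"
proof -
  obtain Q c \<phi> where \<phi>: "smooth_on (xy1_proj M) \<phi>" and Q: "Q = (\<lambda>(x, y, y1). c * y + \<phi> (x, y1))"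
    and lin: "linearized_symmetry_condition n U \<omega> Q" and XQ: "X = char_field M Q"
    using X unfolding uniform_generators_def M by blast
  define Q' where "Q' = (\<lambda>(x, y, y1). c * y + pulled_part c \<phi> (x, y1))"
  have smooth: "smooth_on M Q" "smooth_on M Q'"
    unfolding Q Q'_def by (intro smooth_on_affine_characteristic smooth_on_pulled_part \<phi>)+
  have rel: "k * Q' m = Q (\<Gamma> m)" if "m \<in> M" for m
    unfolding Q Q'_def by (rule pulled_part_relation[OF that])
  have "pullback M \<Gamma> X = char_field M Q'"
    unfolding XQ by (rule pullback_char_field[OF smooth rel])
  moreover have "linearized_symmetry_condition n U \<omega> Q'"
    by (rule linearized_symmetry_condition_pullback[OF n ode M symmetry smooth rel lin])
  ultimately show ?thesis
    using smooth_on_pulled_part[OF \<phi>, of c] unfolding uniform_generators_def M[symmetric] Q'_def by blast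
qed

lemma smooth_on_generator:
  assumes "M = base ` U" "X \<in> uniform_generators n U \<omega>"
  shows "smooth_on M X"
proof -
  obtain Q c \<phi> where \<phi>: "smooth_on (xy1_proj M) \<phi>" and Q: "Q = (\<lambda>(x, y, y1). c * y + \<phi> (x, y1))"
    and XQ: "X = char_field M Q"
    using assms(2) unfolding uniform_generators_def assms(1) by blast
  show ?thesis unfolding XQ Q
    by (intro smooth_on_char_field open_M smooth_on_affine_characteristic \<phi>)
qed

end

section \<open>Change of basis under an injective linear map\<close>

text \<open>
  The images of the basis are independent and as many as the basis vectors, hence span the same
  space. The coefficient matrix \<open>b\<close> is invertible since its product with the matrix of \<open>T\<close> expresses
  the basis by itself.
\<close>

lemma injective_endomorphism_basis_change:
  fixes X :: "'i::finite \<Rightarrow> 'v::real_vector" and T :: "'v \<Rightarrow> 'v"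
  assumes T: "linear T" and inj: "inj X" and indep: "independent (range X)"
    and into: "\<And>i. T (X i) \<in> span (range X)" and inj_T: "inj_on T (span (range X))"
  shows "bij_betw T (span (range X)) (span (range X))"
    and "\<exists>b :: real^'i^'i. invertible b \<and> (\<forall>i. X i = (\<Sum>l\<in>UNIV. b $ i $ l *\<^sub>R T (X l)))"
proof -
  define Y where "Y = (\<lambda>i. T (X i))"
  have range_Y: "range Y = T ` range X" by (auto simp: Y_def)
  have inj_TX: "inj_on T (range X)" by (rule inj_on_subset[OF inj_T span_superset])
  have inj_Y: "inj Y"
    using inj inj_TX by (auto simp: Y_def inj_def inj_on_def)
  have indep_Y: "independent (range Y)"
    unfolding range_Y by (rule linear_independent_injective_image[OF T indep inj_T])
  have Y_into: "range Y \<subseteq> span (range X)" using into by (auto simp: Y_def)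
  have card_Y: "card (range Y) = card (range X)" by (simp add: card_image inj inj_Y)
  have X_in: "range X \<subseteq> span (range Y)"
  proof
    fix x assume x: "x \<in> range X"
    show "x \<in> span (range Y)"
    proof (rule ccontr)
      assume x': "x \<notin> span (range Y)"
      then have "independent (insert x (range Y))" using indep_Y by (rule independent_insertI)
      moreover have "insert x (range Y) \<subseteq> span (range X)" using span_base[OF x] Y_into by simp
      ultimately have "card (insert x (range Y)) \<le> card (range X)"
        using independent_span_bound[of "range X"] by simp
      moreover have "x \<notin> range Y" using x' span_base[of x "range Y"] by auto
      ultimately show False using card_Y by simp
    qed
  qed
  have span_eq: "span (range Y) = span (range X)"
    by (rule span_eq[THEN iffD2]) (use X_in Y_into in blast)
  have "T ` span (range X) = span (range X)"
    using linear_span_image[OF T, of "range X"] span_eq range_Y by simp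
  with inj_T show "bij_betw T (span (range X)) (span (range X))" by (simp add: bij_betw_def)

  have coefficients: "\<exists>c. v = (\<Sum>l\<in>UNIV. c l *\<^sub>R Z l)" if "inj Z" "v \<in> span (range Z)"
    for Z :: "'i \<Rightarrow> 'v" and v
  proof -
    obtain u where "v = (\<Sum>w\<in>range Z. u w *\<^sub>R w)"
      using \<open>v \<in> span (range Z)\<close> by (auto simp: span_finite)
    then have "v = (\<Sum>l\<in>UNIV. u (Z l) *\<^sub>R Z l)" by (simp add: sum.reindex[OF that(1)])
    then show ?thesis by (rule exI[where x = "\<lambda>l. u (Z l)"])
  qed
  have "\<forall>i. \<exists>c. X i = (\<Sum>l\<in>UNIV. c l *\<^sub>R Y l)" using coefficients[OF inj_Y] X_in by blast
  then obtain b where b: "\<And>i. X i = (\<Sum>l\<in>UNIV. b i l *\<^sub>R Y l)" by metis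
  have "\<forall>l. \<exists>c. Y l = (\<Sum>m\<in>UNIV. c m *\<^sub>R X m)" using coefficients[OF inj] Y_into by blast
  then obtain a where a: "\<And>l. Y l = (\<Sum>m\<in>UNIV. a l m *\<^sub>R X m)" by metis
  define b' where "b' = (\<chi> i l. b i l)"
  define a' where "a' = (\<chi> l m. a l m)"
  have unique: "d m = 0" if "(\<Sum>m\<in>UNIV. d m *\<^sub>R X m) = 0" for d :: "'i \<Rightarrow> real" and m
  proof -
    have "(\<Sum>v\<in>range X. d (inv X v) *\<^sub>R v) = 0"
      using that by (simp add: sum.reindex[OF inj] inv_f_f[OF inj])
    from independentD[OF indep _ order_refl this, of "X m"] show ?thesis
      by (simp add: inv_f_f[OF inj])
  qed
  have "b' ** a' = mat 1"
  proof -
    have "(b' ** a') $ i $ m - mat 1 $ i $ m = 0" for i m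
    proof (rule unique[where d = "\<lambda>m. (b' ** a') $ i $ m - mat 1 $ i $ m"])
      have "X i = (\<Sum>l\<in>UNIV. \<Sum>m\<in>UNIV. (b i l * a l m) *\<^sub>R X m)"
        by (subst b) (simp add: a scaleR_sum_right)
      also have "\<dots> = (\<Sum>m\<in>UNIV. (b' ** a') $ i $ m *\<^sub>R X m)"
        by (subst sum.swap) (simp add: matrix_matrix_mult_def a'_def b'_def scaleR_sum_left)
      moreover have "(\<Sum>m\<in>UNIV. mat 1 $ i $ m *\<^sub>R X m) = X i"
        by (simp add: mat_def if_distrib[of "\<lambda>r. r *\<^sub>R _"] cong: if_cong)
      ultimately show "(\<Sum>m\<in>UNIV. ((b' ** a') $ i $ m - mat 1 $ i $ m) *\<^sub>R X m) = 0"
        by (simp add: scaleR_diff_left sum_subtractf)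
    qed
    then show ?thesis by (simp add: vec_eq_iff)
  qed
  then have "invertible b'" by (metis invertible_def matrix_left_right_inverse)
  moreover have "X i = (\<Sum>l\<in>UNIV. b' $ i $ l *\<^sub>R T (X l))" for i
    using b[of i] by (simp add: b'_def Y_def)
  ultimately show "\<exists>b :: real^'i^'i. invertible b \<and> (\<forall>i. X i = (\<Sum>l\<in>UNIV. b $ i $ l *\<^sub>R T (X l)))"
    by blast
qed

section \<open>The automorphism induced by a uniform contact symmetry\<close>

lemma contact_transformation_of_symmetry:
  assumes ode: "ode_rhs n U \<omega>" and "uniform_contact_symmetry n U \<omega> \<Gamma>"
  obtains k \<Phi> \<Theta> \<Psi> where "contact_transformation (base ` U) \<Gamma> k \<Phi> \<Theta> \<Psi>"
proof -
  have "open (base ` U)" using ode by (intro open_base_image) (simp add: ode_rhs_def)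
  moreover have "uniform_contact_transformation (base ` U) \<Gamma>"
    using assms(2) by (simp add: uniform_contact_symmetry_def)
  ultimately show ?thesis
    using that unfolding uniform_contact_transformation_def contact_transformation_def by fast
qed

theorem lemma2:
  fixes n :: nat and U :: "jet set" and \<omega> :: "jet \<Rightarrow> real"
    and M :: "point set" and L :: "vfield set"
    and X :: "'i::finite \<Rightarrow> vfield" and c :: "'i \<Rightarrow> 'i \<Rightarrow> 'i \<Rightarrow> real"
    and \<Gamma> :: "point \<Rightarrow> point"
  defines "M \<equiv> base ` U"
    and "L \<equiv> uniform_generators n U \<omega>"
  assumes "n \<ge> 2" and "ode_rhs n U \<omega>"
    and basis: "inj X" "independent (range X)" "span (range X) = L"
    and structure_constants: "\<And>i j. lie_bracket M (X i) (X j) = (\<Sum>k\<in>UNIV. c i j k *\<^sub>R X k)"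
    and symmetry: "uniform_contact_symmetry n U \<omega> \<Gamma>"
  shows "(\<forall>i. pullback M \<Gamma> (X i) \<in> L) \<and>
    (\<exists>T. (\<forall>i. T (X i) = pullback M \<Gamma> (X i)) \<and> lie_automorphism M L T) \<and>
    (\<exists>b :: real^'i^'i. invertible b \<and>
       (\<forall>i. X i = (\<Sum>l\<in>UNIV. b $ i $ l *\<^sub>R pullback M \<Gamma> (X l)))) \<and>
    (\<forall>i j. lie_bracket M (pullback M \<Gamma> (X i)) (pullback M \<Gamma> (X j))
       = (\<Sum>k\<in>UNIV. c i j k *\<^sub>R pullback M \<Gamma> (X k)))"
proof -
  obtain k \<Phi> \<Theta> \<Psi> where "contact_transformation M \<Gamma> k \<Phi> \<Theta> \<Psi>"
    unfolding M_def by (rule contact_transformation_of_symmetry[OF assms(4) symmetry])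
  then interpret contact_transformation M \<Gamma> k \<Phi> \<Theta> \<Psi> .
  let ?T = "pullback M \<Gamma>"
  have M: "M = base ` U" by (simp add: M_def)
  have into: "?T Z \<in> L" if "Z \<in> L" for Z
    using pullback_generator[OF assms(3,4) M symmetry] that unfolding L_def by blast
  have smooth: "smooth_on M Z" if "Z \<in> L" for Z
    using smooth_on_generator[OF M] that unfolding L_def by blast
  have vanish: "Z m = 0" if "Z \<in> L" "m \<notin> M" for Z m
    using that by (auto simp: L_def uniform_generators_def char_field_def M)
  have X: "X i \<in> L" for i using span_superset[of "range X"] basis(3) by blast
  have bracket: "?T (lie_bracket M Y Z) = lie_bracket M (?T Y) (?T Z)" if "Y \<in> L" "Z \<in> L" for Y Z
    using that by (intro pullback_lie_bracket smooth into)
  have "inj_on ?T L"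
    by (rule inj_onI) (use pullback_injective vanish in metis)
  then have inj: "inj_on ?T (span (range X))" by (simp only: basis(3))
  have TX: "?T (X i) \<in> span (range X)" for i using into[OF X] basis(3) by simp
  note basis_change = injective_endomorphism_basis_change[OF linear_pullback basis(1,2) TX inj]
  have "lie_automorphism M L ?T"
    using basis_change(1) bracket
    by (simp add: lie_automorphism_def basis(3) linear_add[OF linear_pullback]
        linear_cmul[OF linear_pullback])
  moreover have "lie_bracket M (?T (X i)) (?T (X j)) = (\<Sum>k\<in>UNIV. c i j k *\<^sub>R ?T (X k))" for i j
    by (simp add: bracket[OF X X, symmetric] structure_constants linear_sum[OF linear_pullback]
        linear_cmul[OF linear_pullback])
  ultimately show ?thesis using into[OF X] basis_change(2) by blast
qed

end
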